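(* Let $\mu>0$ and $a\in\mathbb R$, and consider the semilinear parabolic system $$\frac{\partial x}{\partial t}(t,z)=\mu\frac{\partial^2x}{\partial z^2}(t,z)+a\,x(t,z)-x^3(t,z),\quad t>0,\ z\in(0,1),$$ with boundary conditions $$\frac{\partial x}{\partial z}(t,0)=u(t),\qquad x(t,1)=0,\qquad t>0,$$ with $X:=L_2(0,1)$ and $\mathcal U:=C^2(\mathbb R_+,\mathbb R)$ (with the supremum norm). If $a<\frac{\mu\pi^2}{4}$, then the system is ISS. If $a>\frac{\mu\pi^2}{4}$, then the system is not uniformly asymptotically stable at zero (not 0-UAS).
   Context: $\mathbb R_+=[0,\infty)$. Solutions are understood in the classical sense: a real-valued function $x$, continuous on $[0,\infty)\times[0,1]$, continuously differentiable in $t$ and twice continuously differentiable in $z$ on $(0,\infty)\times[0,1]$, satisfying the equation and boundary conditions. The stability estimates are required only for classical solutions (i.e. for sufficiently smooth initial states); the state is measured in the $L_2(0,1)$-norm and the input in the norm $\|u\|_{\mathcal U}=\sup_{t\ge0}|u(t)|$. $\mathcal K_\infty$ is the set of continuous, strictly increasing, unbounded $\gamma:\mathbb R_+\to\mathbb R_+$ with $\gamma(0)=0$; $\mathcal{KL}$ is the set of continuous $\beta:\mathbb R_+^2\to\mathbb R_+$ such that $\beta(\cdot,t)$ is strictly increasing with $\beta(0,t)=0$ for all $t\ge0$, and $\beta(r,\cdot)$ is strictly decreasing to $0$ for all $r>0$. ISS: there exist $\beta\in\mathcal{KL}$, $\gamma\in\mathcal K_\infty$ such that $\|x(t,\cdot)\|_{L_2(0,1)}\le\beta(\|x(0,\cdot)\|_{L_2(0,1)},t)+\gamma(\|u\|_{\mathcal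 U})$ for all $t\ge0$ and all solutions $x$ with input $u\in\mathcal U$. 0-UAS: there exist $\beta\in\mathcal{KL}$ and $r>0$ such that for $u\equiv0$ every solution with $\|x(0,\cdot)\|_{L_2(0,1)}\le r$ satisfies $\|x(t,\cdot)\|_{L_2(0,1)}\le\beta(\|x(0,\cdot)\|_{L_2(0,1)},t)$ for all $t\ge0$. *)

theory Defs
  imports "HOL-Analysis.Analysis"
begin

text \<open>
  Functions on \<open>[0,\<infinity>)\<close> or \<open>[0,\<infinity>) \<times> [0,1]\<close> are total functions on the reals of which only the values
  on that domain matter. At boundary points of the domain, derivatives are one-sided.
\<close>

subsection \<open>Comparison functions\<close>

definition class_K_inf :: "(real \<Rightarrow> real) set" where
  "class_K_inf = {\<gamma>. \<gamma> ` {0..} \<subseteq> {0..} \<and> continuous_on {0..} \<gamma> \<and> strict_mono_on {0..} \<gamma> \<and>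
     \<gamma> 0 = 0 \<and> \<not> bdd_above (\<gamma> ` {0..})}"

definition class_KL :: "(real \<Rightarrow> real \<Rightarrow> real) set" where
  "class_KL = {\<beta>. (\<forall>r\<ge>0. \<forall>t\<ge>0. \<beta> r t \<ge> 0) \<and>
     continuous_on ({0..} \<times> {0..}) (\<lambda>(r, t). \<beta> r t) \<and>
     (\<forall>t\<ge>0. strict_mono_on {0..} (\<lambda>r. \<beta> r t) \<and> \<beta> 0 t = 0) \<and>
     (\<forall>r>0. strict_antimono_on {0..} (\<beta> r) \<and> (\<beta> r \<longlongrightarrow> 0) at_top)}"

subsection \<open>Inputs and states\<close>

text \<open>
  The input space is normed by the supremum, so its elements are the bounded functions of class
  \<open>C\<^sup>2\<close>; for an unbounded input the ISS estimate would be void, its right-hand side being infinite.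
\<close>

definition input_space :: "(real \<Rightarrow> real) set" where
  "input_space = {u. bounded (u ` {0..}) \<and>
     (\<exists>u' u''. (\<forall>t\<ge>0. (u has_real_derivative u' t) (at t within {0..}) \<and>
                      (u' has_real_derivative u'' t) (at t within {0..})) \<and>
        continuous_on {0..} u'')}"

definition input_norm :: "(real \<Rightarrow> real) \<Rightarrow> real" where
  "input_norm u = (SUP t\<in>{0..}. \<bar>u t\<bar>)"

definition L2_norm :: "(real \<Rightarrow> real) \<Rightarrow> real" where
  "L2_norm f = sqrt (LINT z:{0<..<1}|lborel. (f z)\<^sup>2)"

subsection \<open>The system\<close>

text \<open>
  In \<open>x t z\<close> the first argument is time. The functions \<open>xt\<close>, \<open>xz\<close>, \<open>xzz\<close> are the derivatives
  \<open>\<partial>\<^sub>t x\<close>, \<open>\<partial>\<^sub>z x\<close>, \<open>\<partial>\<^sub>z\<^sub>z x\<close>, which are required to be jointly continuous in \<open>(t,z)\<close>.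
\<close>

definition classical_solution ::
    "real \<Rightarrow> real \<Rightarrow> (real \<Rightarrow> real) \<Rightarrow> (real \<Rightarrow> real \<Rightarrow> real) \<Rightarrow> bool" where
  "classical_solution \<mu> a u x \<longleftrightarrow>
     continuous_on ({0..} \<times> {0..1}) (\<lambda>(t, z). x t z) \<and>
     (\<exists>xt xz xzz.
        (\<forall>t>0. \<forall>z\<in>{0..1}.
           ((\<lambda>s. x s z) has_real_derivative xt t z) (at t) \<and>
           (x t has_real_derivative xz t z) (at z within {0..1}) \<and>
           (xz t has_real_derivative xzz t z) (at z within {0..1})) \<and>
        continuous_on ({0<..} \<times> {0..1}) (\<lambda>(t, z). xt t z) \<and>
        continuous_on ({0<..} \<times> {0..1}) (\<lambda>(t, z). xz t z) \<and>
        continuous_on ({0<..} \<times> {0..1}) (\<lambda>(t, z). xzz t z) \<and>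
        (\<forall>t>0. \<forall>z\<in>{0<..<1}. xt t z = \<mu> * xzz t z + a * x t z - (x t z) ^ 3) \<and>
        (\<forall>t>0. xz t 0 = u t \<and> x t 1 = 0))"

definition ISS :: "real \<Rightarrow> real \<Rightarrow> bool" where
  "ISS \<mu> a \<longleftrightarrow>
     (\<exists>\<beta>\<in>class_KL. \<exists>\<gamma>\<in>class_K_inf. \<forall>u\<in>input_space. \<forall>x. classical_solution \<mu> a u x \<longrightarrow>
        (\<forall>t\<ge>0. L2_norm (x t) \<le> \<beta> (L2_norm (x 0)) t + \<gamma> (input_norm u)))"

definition zero_UAS :: "real \<Rightarrow> real \<Rightarrow> bool" where
  "zero_UAS \<mu> a \<longleftrightarrow>
     (\<exists>\<beta>\<in>class_KL. \<exists>r>0. \<forall>x. classical_solution \<mu> a (\<lambda>t. 0) x \<and> L2_norm (x 0) \<le> r \<longrightarrow>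
        (\<forall>t\<ge>0. L2_norm (x t) \<le> \<beta> (L2_norm (x 0)) t))"

end

theory Submission
  imports Defs
begin

text \<open>
  For \<open>a < \<mu>\<pi>\<^sup>2/4\<close> choose \<open>\<kappa>, \<eta> > 0\<close> with \<open>\<mu>\<kappa>\<^sup>2 > a\<close> and \<open>\<kappa> + \<eta> < \<pi>/2\<close>. The derivative in \<open>z\<close> of
  \<open>x x\<^sub>z + \<kappa> tan(\<kappa>z + \<eta>) x\<^sup>2\<close> equals \<open>x x\<^sub>z\<^sub>z + \<kappa>\<^sup>2x\<^sup>2 + (x\<^sub>z + \<kappa> tan(\<kappa>z + \<eta>) x)\<^sup>2\<close>. Integrating it gives
  the Poincare inequality together with a term \<open>- \<kappa> tan \<eta> x(t,0)\<^sup>2\<close> that absorbs the boundary term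
  \<open>- x(t,0) u(t)\<close>, so the squared norm \<open>V\<close> satisfies \<open>V' \<le> -cV + D u\<^sup>2\<close> with \<open>c = 2(\<mu>\<kappa>\<^sup>2 - a) > 0\<close>.

  For \<open>a > \<mu>\<pi>\<^sup>2/4\<close> the function \<open>\<epsilon> cos(\<pi>z/2)\<close> with small \<open>\<epsilon>\<close> is a stationary subsolution. The solution
  starting there never falls below it, hence does not tend to \<open>0\<close>, although its initial norm is as
  small as we like. This solution exists globally: writing the equation as
  \<open>x\<^sub>t = \<mu>x\<^sub>z\<^sub>z - Kx + F(x)\<close> with \<open>K = 2a\<close> and \<open>F(v) = 3av - v\<^sup>3\<close>, the function \<open>F\<close> is increasing on
  \<open>[0, \<surd>a]\<close> and \<open>F(\<surd>a) = K\<surd>a\<close>, so the linear problems \<open>x\<^sub>t = \<mu>x\<^sub>z\<^sub>z - Kx + F(y)\<close> produce an increasing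
  sequence of iterates with values in \<open>[0, \<surd>a]\<close>. Its convergence and the smoothness of the limit are
  controlled through the cosine coefficients, which by orthogonality are bounded by the supremum of
  the function and gain a factor \<open>n\<^sup>-\<^sup>2\<close> with each linear solve.
\<close>

section \<open>Input-to-state stability\<close>

lemma set_lint_open_unit_eq_integral:
  fixes f :: "real \<Rightarrow> real"
  assumes "continuous_on {0..1} f"
  shows "(LINT z:{0<..<1}|lborel. f z) = integral {0..1} f"
proof -
  have "set_integrable lborel {0..1} f"
    using borel_integrable_compact[OF _ assms] unfolding set_integrable_def
    by (simp add: indicator_def if_distrib[of "\<lambda>c. c *\<^sub>R _"] cong: if_cong)
  then have "set_integrable lborel {0<..<1} f"
    by (rule set_integrable_subset) auto
  then show ?thesis
    using integral_open_interval_real[of 0 1 f] by (simp add: set_borel_integral_eq_integral(2))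
qed

lemma L2_norm_eq:
  assumes "continuous_on {0..1} f"
  shows "L2_norm f = sqrt (integral {0..1} (\<lambda>z. (f z)\<^sup>2))"
  unfolding L2_norm_def using assms
  by (subst set_lint_open_unit_eq_integral) (auto intro!: continuous_intros)

lemma continuous_on_slice:
  assumes "continuous_on (A \<times> B) (\<lambda>(t, z). f t z)" "t \<in> A"
  shows "continuous_on B (f t)"
proof -
  have "continuous_on B (\<lambda>z. (t, z))" by (intro continuous_intros)
  then show ?thesis
    using continuous_on_compose2[OF assms(1), of B "\<lambda>z. (t, z)"] assms(2) by auto
qed

lemma weighted_poincare:
  fixes y y' y'' :: "real \<Rightarrow> real"
  assumes "\<kappa> > 0" "\<eta> > 0" "\<kappa> + \<eta> < pi / 2"
    and y': "\<And>z. z \<in> {0..1} \<Longrightarrow> (y has_real_derivative y' z) (at z within {0..1})"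
    and y'': "\<And>z. z \<in> {0..1} \<Longrightarrow> (y' has_real_derivative y'' z) (at z within {0..1})"
    and cont: "continuous_on {0..1} y''"
    and "y 1 = 0"
  shows "integral {0..1} (\<lambda>z. y z * y'' z + \<kappa>\<^sup>2 * (y z)\<^sup>2) \<le> - y 0 * y' 0 - \<kappa> * tan \<eta> * (y 0)\<^sup>2"
proof -
  define T where "T z = tan (\<kappa> * z + \<eta>)" for z
  define F where "F z = y z * y' z + \<kappa> * T z * (y z)\<^sup>2" for z
  have arg: "0 < \<kappa> * z + \<eta>" "\<kappa> * z + \<eta> < pi / 2" if "z \<in> {0..1}" for z
  proof -
    have "0 \<le> \<kappa> * z" "\<kappa> * z \<le> \<kappa>"
      using that assms(1) by (auto intro: mult_left_le)
    with assms(2,3) show "0 < \<kappa> * z + \<eta>" "\<kappa> * z + \<eta> < pi / 2" by linarith+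
  qed
  have cos_nz: "cos (\<kappa> * z + \<eta>) \<noteq> 0" if "z \<in> {0..1}" for z
    using cos_gt_zero_pi[of "\<kappa> * z + \<eta>"] arg[OF that] by auto
  have T': "(T has_real_derivative \<kappa> * (1 + (T z)\<^sup>2)) (at z within {0..1})" if "z \<in> {0..1}" for z
    unfolding T_def using cos_nz[OF that]
    by (auto intro!: derivative_eq_intros simp: tan_sec inverse_eq_divide field_simps)
  have cy: "continuous_on {0..1} y" and cy': "continuous_on {0..1} y'"
    using y' y'' by (meson DERIV_continuous continuous_on_eq_continuous_within)+
  have cT: "continuous_on {0..1} T"
    using T' by (meson DERIV_continuous continuous_on_eq_continuous_within)
  have F': "(F has_real_derivative
      y z * y'' z + \<kappa>\<^sup>2 * (y z)\<^sup>2 + (y' z + \<kappa> * T z * y z)\<^sup>2) (at z within {0..1})"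
    if "z \<in> {0..1}" for z
    unfolding F_def
    by (rule derivative_eq_intros y'[OF that] y''[OF that] T'[OF that] refl)+
      (simp add: power2_eq_square algebra_simps)
  have "((\<lambda>z. y z * y'' z + \<kappa>\<^sup>2 * (y z)\<^sup>2 + (y' z + \<kappa> * T z * y z)\<^sup>2) has_integral F 1 - F 0) {0..1}"
    by (rule fundamental_theorem_of_calculus)
      (use F' in \<open>auto simp: has_real_derivative_iff_has_vector_derivative[symmetric]\<close>)
  moreover have "((\<lambda>z. y z * y'' z + \<kappa>\<^sup>2 * (y z)\<^sup>2)
      has_integral integral {0..1} (\<lambda>z. y z * y'' z + \<kappa>\<^sup>2 * (y z)\<^sup>2)) {0..1}"
    by (intro integrable_integral integrable_continuous_real continuous_intros cy cont)
  ultimately have "integral {0..1} (\<lambda>z. y z * y'' z + \<kappa>\<^sup>2 * (y z)\<^sup>2) \<le> F 1 - F 0"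
    by (elim has_integral_le[rotated]) auto
  also have "F 1 - F 0 = - y 0 * y' 0 - \<kappa> * tan \<eta> * (y 0)\<^sup>2"
    using assms by (simp add: F_def T_def)
  finally show ?thesis .
qed

lemma input_norm_ge:
  assumes "u \<in> input_space" "t \<ge> 0"
  shows "\<bar>u t\<bar> \<le> input_norm u"
proof -
  have "bounded (u ` {0..})" using assms by (simp add: input_space_def)
  then obtain B where B: "\<And>t. t \<ge> 0 \<Longrightarrow> \<bar>u t\<bar> \<le> B"
    unfolding bounded_iff by auto
  show ?thesis unfolding input_norm_def
    by (rule cSUP_upper) (use assms B in \<open>auto intro!: bdd_aboveI[of _ B]\<close>)
qed

lemma exponential_KL:
  assumes "c > (0::real)"
  shows "(\<lambda>r t. r * exp (- c * t)) \<in> class_KL"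
  unfolding class_KL_def
proof (intro CollectI conjI allI impI)
  show "continuous_on ({0..} \<times> {0..}) (\<lambda>(r, t). r * exp (- c * t))"
    by (auto intro!: continuous_intros simp: case_prod_beta)
  fix r :: real assume "r > 0"
  then show "strict_antimono_on {0..} (\<lambda>t. r * exp (- c * t))"
    using assms by (auto intro!: monotone_onI)
  have "((\<lambda>t. exp (- c * t)) \<longlongrightarrow> 0) at_top"
    using assms by (auto intro!: exp_at_bot[THEN filterlim_compose] filterlim_ident
        filterlim_tendsto_pos_mult_at_top[OF tendsto_const] simp: filterlim_uminus_at_bot)
  then show "((\<lambda>t. r * exp (- c * t)) \<longlongrightarrow> 0) at_top"
    by (rule tendsto_mult_right_zero)
qed (auto intro!: strict_mono_onI)

lemma linear_K_inf:
  assumes "c > (0::real)"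
  shows "(\<lambda>s. c * s) \<in> class_K_inf"
proof -
  have "\<not> bdd_above ((\<lambda>s. c * s) ` {0..})"
  proof
    assume "bdd_above ((\<lambda>s. c * s) ` {0..})"
    then obtain B where B: "\<And>s. s \<ge> 0 \<Longrightarrow> c * s \<le> B" by (auto simp: bdd_above_def)
    from B[of "(\<bar>B\<bar> + 1) / c"] assms show False by simp
  qed
  then show ?thesis using assms
    by (auto simp: class_K_inf_def intro!: continuous_intros strict_mono_onI)
qed

lemma exponential_decay_bound:
  fixes V V' :: "real \<Rightarrow> real"
  assumes c: "c > 0" and "t \<ge> 0" and cont: "continuous_on {0..} V"
    and V': "\<And>s. s > 0 \<Longrightarrow> (V has_real_derivative V' s) (at s)"
    and le: "\<And>s. s > 0 \<Longrightarrow> V' s \<le> - c * V s + d"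
  shows "V t \<le> exp (- c * t) * V 0 + (1 - exp (- c * t)) * (d / c)"
proof -
  define W where "W s = exp (c * s) * (V s - d / c)" for s
  have "W t \<le> W 0"
  proof (rule DERIV_nonpos_imp_decreasing_open[OF \<open>t \<ge> 0\<close>])
    show "continuous_on {0..t} W"
      unfolding W_def by (intro continuous_intros continuous_on_subset[OF cont]) auto
    fix s assume s: "0 < s" "s < t"
    have "(W has_real_derivative exp (c * s) * (c * V s - d + V' s)) (at s)"
      unfolding W_def using V'[OF s(1)] c
      by (auto intro!: derivative_eq_intros simp: field_simps)
    moreover have "exp (c * s) * (c * V s - d + V' s) \<le> 0"
      using le[OF s(1)] by (intro mult_nonneg_nonpos) auto
    ultimately show "\<exists>y. (W has_real_derivative y) (at s) \<and> y \<le> 0" by blast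
  qed
  then have "exp (- c * t) * W t \<le> exp (- c * t) * W 0" by simp
  moreover have "exp (- c * t) * W t = V t - d / c"
    by (simp add: W_def mult.assoc[symmetric] exp_minus_inverse flip: exp_add)
  ultimately show ?thesis by (simp add: W_def algebra_simps)
qed

lemma energy_inequality:
  assumes "\<mu> > 0" "\<kappa> > 0" "\<eta> > 0" "\<kappa> + \<eta> < pi / 2"
    and sol: "classical_solution \<mu> a u x"
  defines "V \<equiv> \<lambda>t. integral {0..1} (\<lambda>z. (x t z)\<^sup>2)"
  shows "continuous_on {0..} V"
    and "\<exists>V'. \<forall>t>0. (V has_real_derivative V' t) (at t) \<and>
      V' t \<le> - 2 * (\<mu> * \<kappa>\<^sup>2 - a) * V t + \<mu> / (2 * \<kappa> * tan \<eta>) * (u t)\<^sup>2"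
proof -
  obtain xt xz xzz where
      cx: "continuous_on ({0..} \<times> {0..1}) (\<lambda>(t, z). x t z)"
    and dxt: "\<And>t z. t > 0 \<Longrightarrow> z \<in> {0..1} \<Longrightarrow> ((\<lambda>s. x s z) has_real_derivative xt t z) (at t)"
    and dxz: "\<And>t z. t > 0 \<Longrightarrow> z \<in> {0..1} \<Longrightarrow> (x t has_real_derivative xz t z) (at z within {0..1})"
    and dxzz: "\<And>t z. t > 0 \<Longrightarrow> z \<in> {0..1} \<Longrightarrow> (xz t has_real_derivative xzz t z) (at z within {0..1})"
    and cxt: "continuous_on ({0<..} \<times> {0..1}) (\<lambda>(t, z). xt t z)"
    and cxzz: "continuous_on ({0<..} \<times> {0..1}) (\<lambda>(t, z). xzz t z)"
    and pde: "\<And>t z. t > 0 \<Longrightarrow> z \<in> {0<..<1} \<Longrightarrow> xt t z = \<mu> * xzz t z + a * x t z - (x t z) ^ 3"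
    and bc: "\<And>t. t > 0 \<Longrightarrow> xz t 0 = u t" "\<And>t. t > 0 \<Longrightarrow> x t 1 = 0"
    by (insert sol[unfolded classical_solution_def], elim conjE exE, rule that) (assumption | blast)+
  have "continuous_on ({0..} \<times> cbox 0 1) (\<lambda>(t, z). (x t z)\<^sup>2)"
    using cx by (auto simp: case_prod_beta intro!: continuous_intros)
  from integral_continuous_on_param[OF this] show "continuous_on {0..} V"
    by (simp add: V_def)
  define V' where "V' t = integral {0..1} (\<lambda>z. 2 * x t z * xt t z)" for t
  have cx0: "continuous_on ({0<..} \<times> {0..1}) (\<lambda>(t, z). x t z)"
    by (rule continuous_on_subset[OF cx]) auto
  have "(V has_real_derivative V' t) (at t)" if "t > 0" for t
  proof -
    have "((\<lambda>t. integral (cbox 0 1) (\<lambda>z. (x t z)\<^sup>2)) has_real_derivative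
        integral (cbox 0 1) (\<lambda>z. 2 * x t z * xt t z)) (at t within {0<..})"
    proof (rule leibniz_rule_field_derivative)
      fix s z :: real assume "s \<in> {0<..}" "z \<in> cbox 0 1"
      then show "((\<lambda>s. (x s z)\<^sup>2) has_real_derivative 2 * x s z * xt s z) (at s within {0<..})"
        using dxt[of s z, THEN DERIV_subset[of _ _ _ UNIV "{0<..}"]]
        by (auto intro!: derivative_eq_intros)
    next
      fix s :: real assume "s \<in> {0<..}"
      then show "(\<lambda>z. (x s z)\<^sup>2) integrable_on cbox 0 1"
        using continuous_on_slice[OF cx0]
        by (auto intro!: integrable_continuous_real continuous_intros)
    next
      show "continuous_on ({0<..} \<times> cbox 0 1) (\<lambda>(s, z). 2 * x s z * xt s z)"
        using cx0 cxt by (auto simp: case_prod_beta intro!: continuous_intros)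
    qed (use that in auto)
    then show ?thesis
      using that by (simp add: V_def V'_def at_within_open[of t "{0<..}"])
  qed
  moreover have "V' t \<le> - 2 * (\<mu> * \<kappa>\<^sup>2 - a) * V t + \<mu> / (2 * \<kappa> * tan \<eta>) * (u t)\<^sup>2" if t: "t > 0" for t
  proof -
    define p where "p = \<kappa> * tan \<eta>"
    have "p > 0" using assms unfolding p_def by (auto intro!: mult_pos_pos tan_gt_zero)
    have c: "continuous_on {0..1} (x t)" "continuous_on {0..1} (xzz t)" "continuous_on {0..1} (xt t)"
      using t continuous_on_slice[OF cx0] continuous_on_slice[OF cxt] continuous_on_slice[OF cxzz] by auto
    have i1: "(\<lambda>z. x t z * xzz t z + \<kappa>\<^sup>2 * (x t z)\<^sup>2) integrable_on {0..1}"
      and i2: "(\<lambda>z. (x t z)\<^sup>2) integrable_on {0..1}"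
      by (intro integrable_continuous_real continuous_intros c)+
    have "V' t = integral {0<..<1} (\<lambda>z. 2 * x t z * xt t z)"
      unfolding V'_def by (rule integral_open_interval_real)
    also have "\<dots> \<le> integral {0<..<1} (\<lambda>z. 2 * \<mu> * (x t z * xzz t z + \<kappa>\<^sup>2 * (x t z)\<^sup>2) - 2 * (\<mu> * \<kappa>\<^sup>2 - a) * (x t z)\<^sup>2)"
    proof (rule integral_le)
      show "(\<lambda>z. 2 * x t z * xt t z) integrable_on {0<..<1}"
        "(\<lambda>z. 2 * \<mu> * (x t z * xzz t z + \<kappa>\<^sup>2 * (x t z)\<^sup>2) - 2 * (\<mu> * \<kappa>\<^sup>2 - a) * (x t z)\<^sup>2) integrable_on {0<..<1}"
        unfolding integrable_on_open_interval_real
        by (intro integrable_continuous_real continuous_intros c)+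
      fix z :: real assume "z \<in> {0<..<1}"
      then have "2 * x t z * xt t z = 2 * \<mu> * (x t z * xzz t z + \<kappa>\<^sup>2 * (x t z)\<^sup>2) - 2 * (\<mu> * \<kappa>\<^sup>2 - a) * (x t z)\<^sup>2 - 2 * ((x t z)\<^sup>2)\<^sup>2"
        by (simp only: pde[OF t]) (simp add: power2_eq_square power3_eq_cube algebra_simps)
      then show "2 * x t z * xt t z \<le> 2 * \<mu> * (x t z * xzz t z + \<kappa>\<^sup>2 * (x t z)\<^sup>2) - 2 * (\<mu> * \<kappa>\<^sup>2 - a) * (x t z)\<^sup>2"
        by simp
    qed
    also have "\<dots> = 2 * \<mu> * integral {0..1} (\<lambda>z. x t z * xzz t z + \<kappa>\<^sup>2 * (x t z)\<^sup>2) - 2 * (\<mu> * \<kappa>\<^sup>2 - a) * V t"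
      unfolding integral_open_interval_real[symmetric] V_def
      by (subst integral_diff) (use i1 i2 in \<open>auto intro!: integrable_on_mult_right\<close>)
    also have "\<dots> \<le> 2 * \<mu> * ((u t)\<^sup>2 / (4 * p)) - 2 * (\<mu> * \<kappa>\<^sup>2 - a) * V t"
    proof -
      have "integral {0..1} (\<lambda>z. x t z * xzz t z + \<kappa>\<^sup>2 * (x t z)\<^sup>2) \<le> - x t 0 * xz t 0 - \<kappa> * tan \<eta> * (x t 0)\<^sup>2"
        by (rule weighted_poincare) (use assms t dxz dxzz bc c in auto)
      also have "\<dots> = (u t)\<^sup>2 / (4 * p) - p * (x t 0 + u t / (2 * p))\<^sup>2"
        using bc(1)[OF t] \<open>p > 0\<close> by (simp add: p_def[symmetric] power2_eq_square field_simps)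
      also have "\<dots> \<le> (u t)\<^sup>2 / (4 * p)" using \<open>p > 0\<close> by simp
      finally show ?thesis using mult_left_mono[of _ _ "2 * \<mu>"] \<open>\<mu> > 0\<close> by fastforce
    qed
    finally show ?thesis by (simp add: p_def mult.assoc left_diff_distrib)
  qed
  ultimately show "\<exists>V'. \<forall>t>0. (V has_real_derivative V' t) (at t) \<and>
      V' t \<le> - 2 * (\<mu> * \<kappa>\<^sup>2 - a) * V t + \<mu> / (2 * \<kappa> * tan \<eta>) * (u t)\<^sup>2" by blast
qed

lemma ISS_if_less:
  assumes "\<mu> > 0" "a < \<mu> * pi\<^sup>2 / 4"
  shows "ISS \<mu> a"
proof -
  obtain \<kappa> where \<kappa>: "0 < \<kappa>" "\<kappa> < pi / 2" "a < \<mu> * \<kappa>\<^sup>2"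
  proof (cases "a \<le> 0")
    case True
    then show ?thesis using that[of 1] assms pi_gt3 by auto
  next
    case False
    then have "sqrt (a / \<mu>) < pi / 2"
      using assms by (intro real_less_lsqrt) (auto simp: power_divide field_simps)
    then obtain k where k: "sqrt (a / \<mu>) < k" "k < pi / 2" using dense by blast
    have "0 \<le> sqrt (a / \<mu>)" using False assms by auto
    with k have "k > 0" by linarith
    have "a / \<mu> < k\<^sup>2" using k(1) \<open>k > 0\<close> real_le_rsqrt[of k "a / \<mu>"] by (meson not_less)
    then have "a < \<mu> * k\<^sup>2" using assms by (simp add: field_simps)
    with that[of k] k \<open>k > 0\<close> show ?thesis by blast
  qed
  define \<eta> where "\<eta> = (pi / 2 - \<kappa>) / 2"
  have \<eta>: "\<eta> > 0" "\<kappa> + \<eta> < pi / 2" "\<eta> < pi / 2" using \<kappa>(1,2) by (simp_all add: \<eta>_def field_simps)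
  define c where "c = 2 * (\<mu> * \<kappa>\<^sup>2 - a)"
  define D where "D = \<mu> / (2 * \<kappa> * tan \<eta>)"
  have "c > 0" using \<kappa> by (simp add: c_def)
  have "D > 0" using \<kappa> \<eta> assms tan_gt_zero[of \<eta>] by (simp add: D_def)
  have "L2_norm (x t) \<le> L2_norm (x 0) * exp (- (c / 2) * t) + sqrt (D / c) * input_norm u"
    if u: "u \<in> input_space" and sol: "classical_solution \<mu> a u x" and t: "t \<ge> 0" for u x t
  proof -
    define V where "V t = integral {0..1} (\<lambda>z. (x t z)\<^sup>2)" for t
    have cont: "continuous_on {0..1} (x s)" if "s \<ge> 0" for s
      using sol that by (auto simp: classical_solution_def intro: continuous_on_slice)
    have norm: "L2_norm (x s) = sqrt (V s)" if "s \<ge> 0" for s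
      unfolding V_def by (intro L2_norm_eq cont that)
    have V0: "V 0 \<ge> 0" unfolding V_def
      by (intro integral_nonneg integrable_continuous_real continuous_intros cont) auto
    note en = energy_inequality[OF assms(1) \<kappa>(1) \<eta>(1,2) sol, folded V_def]
    obtain V' where V': "\<And>s. s > 0 \<Longrightarrow> (V has_real_derivative V' s) (at s)"
      "\<And>s. s > 0 \<Longrightarrow> V' s \<le> - c * V s + D * (u s)\<^sup>2"
      using en(2) unfolding c_def D_def by auto
    define U where "U = input_norm u"
    have uU: "(u s)\<^sup>2 \<le> U\<^sup>2" if "s \<ge> 0" for s
      using input_norm_ge[OF u that] unfolding U_def by (rule abs_le_square_iff[THEN iffD1, OF order_trans]) auto
    have "U \<ge> 0" using input_norm_ge[OF u, of 0] by (simp add: U_def)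
    have "V t \<le> exp (- c * t) * V 0 + (1 - exp (- c * t)) * ((D * U\<^sup>2) / c)"
    proof (rule exponential_decay_bound[OF \<open>c > 0\<close> t en(1) V'(1)])
      fix s :: real assume "s > 0"
      then show "V' s \<le> - c * V s + D * U\<^sup>2"
        using V'(2)[of s] mult_left_mono[OF uU[of s], of D] \<open>D > 0\<close> by linarith
    qed
    also have "\<dots> \<le> exp (- c * t) * V 0 + D / c * U\<^sup>2"
      using \<open>c > 0\<close> \<open>D > 0\<close> by (simp add: field_simps)
    finally have "sqrt (V t) \<le> sqrt (exp (- c * t) * V 0) + sqrt (D / c * U\<^sup>2)"
      using \<open>c > 0\<close> \<open>D > 0\<close> V0
      by (intro order_trans[OF real_sqrt_le_mono sqrt_add_le_add_sqrt]) auto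
    also have "sqrt (exp (- c * t) * V 0) = sqrt (V 0) * exp (- (c / 2) * t)"
    proof -
      have "sqrt (exp (- c * t)) = exp (- (c / 2) * t)"
      by (rule real_sqrt_unique) (auto simp: power2_eq_square simp flip: exp_add)
      then show ?thesis by (simp only: real_sqrt_mult mult.commute)
    qed
    finally show ?thesis
      using t norm \<open>U \<ge> 0\<close> by (simp add: real_sqrt_mult U_def real_sqrt_divide)
  qed
  moreover have "(\<lambda>r t. r * exp (- (c / 2) * t)) \<in> class_KL" using \<open>c > 0\<close> by (intro exponential_KL) auto
  moreover have "(\<lambda>s. sqrt (D / c) * s) \<in> class_K_inf" using \<open>c > 0\<close> \<open>D > 0\<close> by (intro linear_K_inf) auto
  ultimately show ?thesis
    unfolding ISS_def
    by (intro bexI[of _ "\<lambda>r t. r * exp (- (c / 2) * t)"] bexI[of _ "\<lambda>s. sqrt (D / c) * s"]) blast+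
qed

section \<open>Series of functions\<close>

lemma summable_on_majorant:
  fixes f :: "'i \<Rightarrow> real"
  assumes "M summable_on A" "\<And>n. n \<in> A \<Longrightarrow> \<bar>f n\<bar> \<le> M n"
  shows "f summable_on A"
  using Infinite_Sum.abs_summable_on_comparison_test'[OF assms(1), of f] assms(2)
  by (auto intro: abs_summable_summable)

lemma continuous_on_infsum:
  fixes f :: "'i \<Rightarrow> 'a::topological_space \<Rightarrow> real"
  assumes "M summable_on UNIV" "\<And>n y. y \<in> S \<Longrightarrow> \<bar>f n y\<bar> \<le> M n" "\<And>n. continuous_on S (f n)"
  shows "continuous_on S (\<lambda>y. \<Sum>\<^sub>\<infinity>n. f n y)"
proof (rule uniform_limit_theorem)
  show "uniform_limit S (\<lambda>X y. \<Sum>n\<in>X. f n y) (\<lambda>y. \<Sum>\<^sub>\<infinity>n. f n y) (finite_subsets_at_top UNIV)"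
    by (rule Weierstrass_m_test_general) (use assms in auto)
qed (use assms in \<open>auto intro!: always_eventually continuous_intros\<close>)

lemma has_sum_integral:
  fixes f :: "'i \<Rightarrow> real \<Rightarrow> real"
  assumes "M summable_on UNIV" "\<And>n y. y \<in> {a..b} \<Longrightarrow> \<bar>f n y\<bar> \<le> M n"
    and cont: "\<And>n. continuous_on {a..b} (f n)"
  shows "((\<lambda>n. integral {a..b} (f n)) has_sum integral {a..b} (\<lambda>y. \<Sum>\<^sub>\<infinity>n. f n y)) UNIV"
proof -
  have "uniform_limit (cbox a b) (\<lambda>X y. \<Sum>n\<in>X. f n y) (\<lambda>y. \<Sum>\<^sub>\<infinity>n. f n y) (finite_subsets_at_top UNIV)"
    by (rule Weierstrass_m_test_general) (use assms in auto)
  then obtain I J where IJ: "\<And>X. ((\<lambda>y. \<Sum>n\<in>X. f n y) has_integral I X) (cbox a b)"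
      "((\<lambda>y. \<Sum>\<^sub>\<infinity>n. f n y) has_integral J) (cbox a b)" "(I \<longlongrightarrow> J) (finite_subsets_at_top UNIV)"
    by (rule uniform_limit_integral_cbox) (use cont in \<open>auto intro!: continuous_intros\<close>)
  have "I X = (\<Sum>n\<in>X. integral {a..b} (f n))" if "finite X" for X
  proof -
    have "((\<lambda>y. \<Sum>n\<in>X. f n y) has_integral (\<Sum>n\<in>X. integral {a..b} (f n))) {a..b}"
      by (intro has_integral_sum that integrable_integral integrable_continuous_real cont)
    then show ?thesis using IJ(1)[of X] by (simp add: has_integral_unique)
  qed
  then have "((\<lambda>X. \<Sum>n\<in>X. integral {a..b} (f n)) \<longlongrightarrow> J) (finite_subsets_at_top UNIV)"
    by (intro Lim_transform_eventually[OF IJ(3)] eventually_finite_subsets_at_top_weakI) auto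
  moreover have "J = integral {a..b} (\<lambda>y. \<Sum>\<^sub>\<infinity>n. f n y)" using IJ(2) by (simp add: integral_unique)
  ultimately show ?thesis unfolding has_sum_def by simp
qed

lemma has_real_derivative_infsum:
  fixes f f' :: "'i \<Rightarrow> real \<Rightarrow> real"
  assumes M: "M summable_on UNIV" "\<And>n y. y \<in> S \<Longrightarrow> \<bar>f n y\<bar> \<le> M n"
    and M': "M' summable_on UNIV" "\<And>n y. y \<in> S \<Longrightarrow> \<bar>f' n y\<bar> \<le> M' n"
    and deriv: "\<And>n y. y \<in> S \<Longrightarrow> (f n has_real_derivative f' n y) (at y)"
    and cont: "\<And>n. continuous_on S (f' n)"
    and S: "open S" "x \<in> S"
  shows "((\<lambda>y. \<Sum>\<^sub>\<infinity>n. f n y) has_real_derivative (\<Sum>\<^sub>\<infinity>n. f' n x)) (at x)"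
proof -
  obtain e where e: "e > 0" "cball x e \<subseteq> S" using S open_contains_cball by blast
  define a b where "a = x - e" and "b = x + e"
  have ab: "{a..b} \<subseteq> S" "a < x" "x < b"
    using e by (auto simp: a_def b_def cball_eq_atLeastAtMost)
  define F where "F y = (\<Sum>\<^sub>\<infinity>n. f n y)" for y
  define F' where "F' y = (\<Sum>\<^sub>\<infinity>n. f' n y)" for y
  have "continuous_on S F'" unfolding F'_def by (rule continuous_on_infsum) (use M' cont in auto)
  then have cF': "continuous_on {a..b} F'" using ab continuous_on_subset by blast
  have summ: "(\<lambda>n. f n y) summable_on UNIV" if "y \<in> S" for y
    by (rule summable_on_majorant[OF M(1)]) (use M that in auto)
  have eq: "F y = integral {a..y} F' + F a" if y: "y \<in> {a..b}" for y
  proof -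
    have sub: "{a..y} \<subseteq> S" using ab y by auto
    have "(f n has_vector_derivative f' n r) (at r within {a..y})" if "r \<in> {a..y}" for n r
      using deriv[of r n] that sub unfolding has_real_derivative_iff_has_vector_derivative
      by (intro has_vector_derivative_at_within[of _ _ _ "{a..y}"]) blast
    then have "integral {a..y} (f' n) = f n y - f n a" for n
      using y by (intro integral_unique fundamental_theorem_of_calculus) auto
    moreover have "((\<lambda>n. integral {a..y} (f' n)) has_sum integral {a..y} F') UNIV"
      unfolding F'_def using sub M'(2)
      by (intro has_sum_integral[OF M'(1)] continuous_on_subset[OF cont sub]) auto
    ultimately have "((\<lambda>n. f n y - f n a) has_sum integral {a..y} F') UNIV" by simp
    moreover have "((\<lambda>n. f n y - f n a) has_sum (F y - F a)) UNIV"
      unfolding F_def using sub y ab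
      by (auto simp: diff_conv_add_uminus simp del: add_uminus_conv_diff
          intro!: has_sum_add has_sum_uminusI has_sum_infsum summ)
    ultimately show ?thesis using has_sum_unique by fastforce
  qed
  have "((\<lambda>y. integral {a..y} F') has_real_derivative F' x) (at x within {a..b})"
    by (rule integral_has_real_derivative[OF cF']) (use ab in auto)
  then have "((\<lambda>y. integral {a..y} F' + F a) has_real_derivative F' x) (at x within {a..b})"
    by (auto intro!: derivative_eq_intros)
  then have "(F has_real_derivative F' x) (at x within {a..b})"
    by (rule has_field_derivative_transform_within[of _ _ _ _ 1]) (use ab in \<open>auto simp: eq[symmetric]\<close>)
  then show ?thesis
    using ab by (simp add: F_def[abs_def] F'_def at_within_Icc_at)
qed

lemma tendsto_infsum_dominated:
  fixes f :: "'j \<Rightarrow> 'i \<Rightarrow> real"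
  assumes "M summable_on UNIV" "\<And>j n. \<bar>f j n\<bar> \<le> M n" "\<And>n. ((\<lambda>j. f j n) \<longlongrightarrow> g n) G" "G \<noteq> bot"
  shows "((\<lambda>j. \<Sum>\<^sub>\<infinity>n. f j n) \<longlongrightarrow> (\<Sum>\<^sub>\<infinity>n. g n)) G"
proof (rule swap_uniform_limit'[where S = UNIV])
  show "uniform_limit UNIV (\<lambda>X j. \<Sum>n\<in>X. f j n) (\<lambda>j. \<Sum>\<^sub>\<infinity>n. f j n) (finite_subsets_at_top UNIV)"
    by (rule Weierstrass_m_test_general) (use assms in auto)
  show "\<forall>\<^sub>F X in finite_subsets_at_top UNIV. ((\<lambda>j. \<Sum>n\<in>X. f j n) \<longlongrightarrow> (\<Sum>n\<in>X. g n)) G"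
    by (intro always_eventually allI tendsto_sum assms)
  have "\<bar>g n\<bar> \<le> M n" for n
    by (rule tendsto_upperbound[OF tendsto_rabs[OF assms(3)]]) (use assms in auto)
  then have "g summable_on UNIV"
    by (intro summable_on_majorant[OF assms(1)])
  then show "((\<lambda>X. \<Sum>n\<in>X. g n) \<longlongrightarrow> (\<Sum>\<^sub>\<infinity>n. g n)) (finite_subsets_at_top UNIV)"
    by (simp add: has_sum_infsum flip: has_sum_def)
qed auto

section \<open>Comparison principle\<close>

lemma comparison_principle:
  fixes v vt vz vzz :: "real \<Rightarrow> real \<Rightarrow> real"
  assumes \<mu>: "\<mu> \<ge> 0" and K: "K \<ge> 0"
    and cont: "continuous_on ({0..} \<times> {-1..1}) (\<lambda>(t, z). v t z)"
    and dt: "\<And>t z. t > 0 \<Longrightarrow> \<bar>z\<bar> < 1 \<Longrightarrow> ((\<lambda>s. v s z) has_real_derivative vt t z) (at t)"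
    and dz: "\<And>t z. t > 0 \<Longrightarrow> \<bar>z\<bar> < 1 \<Longrightarrow> (v t has_real_derivative vz t z) (at z)"
    and dzz: "\<And>t z. t > 0 \<Longrightarrow> \<bar>z\<bar> < 1 \<Longrightarrow> (vz t has_real_derivative vzz t z) (at z)"
    and super: "\<And>t z. t > 0 \<Longrightarrow> \<bar>z\<bar> < 1 \<Longrightarrow> vt t z \<ge> \<mu> * vzz t z - K * v t z"
    and init: "\<And>z. \<bar>z\<bar> \<le> 1 \<Longrightarrow> v 0 z \<ge> 0"
    and bdry: "\<And>t. t > 0 \<Longrightarrow> v t 1 \<ge> 0" "\<And>t. t > 0 \<Longrightarrow> v t (-1) \<ge> 0"
    and "t \<ge> 0" "\<bar>z\<bar> \<le> 1"
  shows "v t z \<ge> 0"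
proof (rule ccontr)
  assume neg: "\<not> v t z \<ge> 0"
  with init[of z] \<open>t \<ge> 0\<close> \<open>\<bar>z\<bar> \<le> 1\<close> have "t > 0" by (cases "t = 0") auto
  define \<delta> where "\<delta> = - v t z / (2 * t)"
  have "\<delta> > 0" using neg \<open>t > 0\<close> by (simp add: \<delta>_def divide_neg_pos)
  define h where "h s y = v s y + \<delta> * s" for s y
  have h_neg: "h t z < 0" using neg \<open>t > 0\<close> by (simp add: h_def \<delta>_def)
  have "continuous_on ({0..t} \<times> {-1..1}) (\<lambda>(s, y). h s y)"
    unfolding h_def case_prod_beta
    by (intro continuous_intros continuous_on_subset[OF cont, unfolded case_prod_beta]) auto
  then obtain s y where sy: "s \<in> {0..t}" "y \<in> {-1..1}"
    and min: "\<And>s' y'. s' \<in> {0..t} \<Longrightarrow> y' \<in> {-1..1} \<Longrightarrow> h s y \<le> h s' y'"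
    using continuous_attains_inf[of "{0..t} \<times> {-1..1}" "\<lambda>(s, y). h s y"] \<open>t > 0\<close>
    by (fastforce intro: compact_Times)
  have hsy: "h s y < 0" using min[of t z] h_neg \<open>t > 0\<close> \<open>\<bar>z\<bar> \<le> 1\<close> by (auto simp: abs_le_iff)
  have "s \<noteq> 0" using hsy init[of y] sy by (auto simp: h_def abs_le_iff)
  then have s: "s > 0" "s \<le> t" using sy by auto
  have vneg: "v s y < 0" using hsy mult_pos_pos[OF \<open>\<delta> > 0\<close> s(1)] by (simp add: h_def)
  then have "y \<noteq> 1" "y \<noteq> -1" using bdry[OF s(1)] by force+
  then have y: "\<bar>y\<bar> < 1" using sy by auto
  have "vt s y + \<delta> \<le> 0"
  proof (rule ccontr)
    assume "\<not> vt s y + \<delta> \<le> 0"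
    moreover have "((\<lambda>s. h s y) has_real_derivative vt s y + \<delta>) (at s)"
      unfolding h_def using dt[OF s(1) y] by (auto intro!: derivative_eq_intros)
    ultimately obtain d where "d > 0" and d: "\<And>r. 0 < r \<Longrightarrow> r < d \<Longrightarrow> h (s - r) y < h s y"
      using DERIV_pos_inc_left by (metis not_le)
    define r where "r = min s d / 2"
    have "0 < r" "r < d" "r < s" using \<open>d > 0\<close> s by (auto simp: r_def)
    then have "h (s - r) y < h s y" "h s y \<le> h (s - r) y"
      using d[of r] min[of "s - r" y] s sy by auto
    then show False by simp
  qed
  moreover have "vzz s y \<ge> 0"
  proof (rule ccontr)
    assume vzz: "\<not> vzz s y \<ge> 0"
    have vmin: "v s y \<le> v s y'" if "\<bar>y'\<bar> < 1" for y'
      using min[of s y'] that sy by (auto simp: h_def abs_less_iff)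
    have "vz s y = 0"
      by (rule DERIV_local_min[OF dz[OF s(1) y], of "1 - \<bar>y\<bar>"]) (use y vmin in auto)
    moreover obtain d where d: "d > 0" "\<And>r. 0 < r \<Longrightarrow> r < d \<Longrightarrow> vz s (y + r) < vz s y"
      using DERIV_neg_dec_right[OF dzz[OF s(1) y]] vzz by (metis not_le)
    ultimately have vz: "vz s y' < 0" if "y < y'" "y' < y + d" for y'
      using d(2)[of "y' - y"] that by auto
    define y2 where "y2 = y + min d (1 - y) / 2"
    have y2: "y < y2" "y2 < y + d" "y2 < 1" using d y by (auto simp: y2_def min_def field_simps)
    have "v s y2 < v s y"
    proof (rule DERIV_neg_imp_decreasing_open[OF y2(1)])
      show "\<exists>l. (v s has_real_derivative l) (at r) \<and> l < 0" if "y < r" "r < y2" for r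
        using dz[OF s(1), of r] vz[of r] that y y2 by (intro exI[of _ "vz s r"]) auto
      show "continuous_on {y..y2} (v s)"
      proof (rule DERIV_continuous_on)
        show "(v s has_real_derivative vz s r) (at r within {y..y2})" if "r \<in> {y..y2}" for r
          by (rule has_field_derivative_at_within[OF dz[OF s(1)]]) (use that y y2 in auto)
      qed
    qed
    with vmin[of y2] y y2 show False by (auto simp: abs_less_iff)
  qed
  ultimately have "vt s y < 0" "\<mu> * vzz s y \<ge> 0" "K * v s y \<le> 0"
    using \<open>\<delta> > 0\<close> \<mu> K vneg by (auto intro: mult_nonneg_nonpos)
  with super[OF s(1) y] show False by linarith
qed

section \<open>Cosine series\<close>

text \<open>
  Coefficients are indexed by all integers and even in the index, so that a product of two cosine
  series has the convolution as its coefficients. The condition at \<open>z = 1\<close> holds because only odd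
  frequencies occur, the one at \<open>z = 0\<close> because the series contains no sines.
\<close>

definition wt :: "int \<Rightarrow> real" where
  "wt n = 1 / (1 + (of_int n)\<^sup>2)"

definition freq :: "int \<Rightarrow> real" where
  "freq n = of_int n * (pi / 2)"

definition cos_series :: "(int \<Rightarrow> real) \<Rightarrow> real \<Rightarrow> real" where
  "cos_series c z = (\<Sum>\<^sub>\<infinity>n. c n * cos (freq n * z))"

definition conv :: "(int \<Rightarrow> real) \<Rightarrow> (int \<Rightarrow> real) \<Rightarrow> int \<Rightarrow> real" where
  "conv c d k = (\<Sum>\<^sub>\<infinity>n. c n * d (k - n))"

definition even_seq :: "(int \<Rightarrow> real) \<Rightarrow> bool" where
  "even_seq c \<longleftrightarrow> (\<forall>n. c (- n) = c n)"

definition odd_supp :: "(int \<Rightarrow> real) \<Rightarrow> bool" where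
  "odd_supp c \<longleftrightarrow> (\<forall>n. even n \<longrightarrow> c n = 0)"

definition wbound :: "real \<Rightarrow> (int \<Rightarrow> real) \<Rightarrow> bool" where
  "wbound B c \<longleftrightarrow> (\<forall>n. \<bar>c n\<bar> \<le> B * wt n)"

lemma wt_pos: "wt n > 0"
  by (simp add: wt_def add_pos_nonneg)

lemma summable_wt: "wt summable_on UNIV"
proof -
  have "(\<lambda>n::nat. wt (int n)) summable_on UNIV"
  proof (rule norm_summable_imp_summable_on, rule summable_comparison_test')
    show "summable (\<lambda>n. inverse (real n ^ 2))" by (rule inverse_power_summable) simp
    show "norm (norm (wt (int n))) \<le> inverse (real n ^ 2)" if "n \<ge> 1" for n
      using that by (simp add: wt_def inverse_eq_divide frac_le)
  qed
  then have 1: "wt summable_on range int"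
    by (subst summable_on_reindex) (auto simp: o_def)
  moreover have "wt (- n) = wt n" for n by (simp add: wt_def)
  ultimately have "(\<lambda>n. wt (- n)) summable_on range int" by simp
  then have "wt summable_on uminus ` range int"
    by (subst summable_on_reindex) (auto simp: o_def)
  with 1 have "wt summable_on (range int \<union> uminus ` range int)"
    by (rule summable_on_union)
  also have "range int \<union> uminus ` range int = UNIV"
    by (auto simp: image_iff) (metis int_cases2)
  finally show ?thesis .
qed

lemma wbound_nonneg: "wbound B c \<Longrightarrow> B \<ge> 0"
  unfolding wbound_def by (metis abs_ge_zero order_trans wt_pos zero_le_mult_iff not_less)

lemma wboundD: "wbound B c \<Longrightarrow> \<bar>c n\<bar> \<le> B * wt n"
  by (simp add: wbound_def)

lemma summable_Bwt: "(\<lambda>n. B * wt n) summable_on UNIV"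
  by (intro summable_on_cmult_right summable_wt)

lemma wbound_summable:
  assumes "wbound B c" "\<And>n. \<bar>e n\<bar> \<le> 1"
  shows "(\<lambda>n. c n * e n) summable_on UNIV"
proof (rule summable_on_majorant[OF summable_Bwt])
  show "\<bar>c n * e n\<bar> \<le> B * wt n" for n
    using mult_mono[OF wboundD[OF assms(1)] assms(2), of n n] wbound_nonneg[OF assms(1)] wt_pos[of n]
    by (simp add: abs_mult)
qed

lemma bij_minus_left: "bij (\<lambda>n. k - n :: int)"
  by (rule bij_betw_byWitness[of _ "\<lambda>n. k - n"]) auto

lemma summable_wt_shift: "(\<lambda>n. wt (k - n)) summable_on UNIV"
  using summable_on_reindex_bij_betw[OF bij_minus_left, of wt k] summable_wt by simp

lemma infsum_wt_shift: "(\<Sum>\<^sub>\<infinity>n. wt (k - n)) = infsum wt UNIV"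
  using infsum_reindex_bij_betw[OF bij_minus_left, of wt k] by simp

lemma wt_mult_le: "wt n * wt (k - n) \<le> 2 * wt k * (wt n + wt (k - n))"
proof -
  define p q r :: real where "p = 1 + (of_int n)\<^sup>2" and "q = 1 + (of_int (k - n))\<^sup>2"
    and "r = 1 + (of_int k)\<^sup>2"
  have pos: "p > 0" "q > 0" "r > 0" by (auto simp: p_def q_def r_def add_pos_nonneg)
  have "0 \<le> (of_int n - of_int (k - n))\<^sup>2 + (3::real)" by simp
  then have "r \<le> 2 * (p + q)"
    by (simp add: p_def q_def r_def power2_eq_square algebra_simps)
  then have "1 / (p * q) \<le> 2 * (p + q) / (r * (p * q))"
    using pos by (simp add: field_simps)
  also have "\<dots> = 2 * (1 / r) * (1 / p + 1 / q)"
    using pos by (simp add: field_simps)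
  finally show ?thesis by (simp add: wt_def p_def q_def r_def)
qed

definition conv_const :: real where
  "conv_const = 4 * infsum wt UNIV"

lemma conv_term_bound:
  assumes "wbound A c" "wbound B d"
  shows "\<bar>c n * d (k - n)\<bar> \<le> A * B * (2 * wt k * (wt n + wt (k - n)))"
proof -
  have "\<bar>c n * d (k - n)\<bar> \<le> (A * wt n) * (B * wt (k - n))"
    unfolding abs_mult
    by (intro mult_mono wboundD[OF assms(1)] wboundD[OF assms(2)])
      (use wbound_nonneg[OF assms(1)] wt_pos[of n] in auto)
  also have "\<dots> = A * B * (wt n * wt (k - n))" by simp
  also have "\<dots> \<le> A * B * (2 * wt k * (wt n + wt (k - n)))"
    by (intro mult_left_mono wt_mult_le mult_nonneg_nonneg)
      (use assms[THEN wbound_nonneg] in auto)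
  finally show ?thesis .
qed

lemma conv_majorant_has_sum:
  "((\<lambda>n. A * B * (2 * wt k * (wt n + wt (k - n)))) has_sum (conv_const * A * B * wt k)) UNIV"
proof -
  have "((\<lambda>n. wt n + wt (k - n)) has_sum (infsum wt UNIV + infsum wt UNIV)) UNIV"
    using summable_wt summable_wt_shift[of k] infsum_wt_shift[of k]
    by (intro has_sum_add) (auto simp: has_sum_iff)
  from has_sum_cmult_right[OF this, of "A * B * (2 * wt k)"] show ?thesis
    by (simp add: conv_const_def mult_ac)
qed

lemma conv_summable:
  assumes "wbound A c" "wbound B d"
  shows "(\<lambda>n. c n * d (k - n)) summable_on UNIV"
  by (rule summable_on_majorant[OF has_sum_imp_summable[OF conv_majorant_has_sum]])
    (rule conv_term_bound[OF assms])

lemma wbound_conv: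
  assumes "wbound A c" "wbound B d"
  shows "wbound (conv_const * A * B) (conv c d)"
  unfolding wbound_def
proof
  fix k
  have "norm (conv c d k) \<le> conv_const * A * B * wt k"
  proof (rule norm_infsum_le)
    show "((\<lambda>n. c n * d (k - n)) has_sum conv c d k) UNIV"
      unfolding conv_def by (intro has_sum_infsum conv_summable[OF assms])
    show "((\<lambda>n. A * B * (2 * wt k * (wt n + wt (k - n)))) has_sum (conv_const * A * B * wt k)) UNIV"
      by (rule conv_majorant_has_sum)
  qed (use conv_term_bound[OF assms] in simp)
  then show "\<bar>conv c d k\<bar> \<le> conv_const * A * B * wt k" by simp
qed

lemma even_conv:
  assumes "even_seq c" "even_seq d"
  shows "even_seq (conv c d)"
  unfolding even_seq_def
proof
  fix k
  have "conv c d (- k) = (\<Sum>\<^sub>\<infinity>n. c (- n) * d (- k - - n))"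
    unfolding conv_def by (rule infsum_reindex_bij_betw[OF bij_uminus, symmetric])
  also have "\<dots> = (\<Sum>\<^sub>\<infinity>n. c n * d (k - n))"
  proof (rule infsum_cong)
    fix n show "c (- n) * d (- k - - n) = c n * d (k - n)"
      using assms by (metis even_seq_def minus_diff_eq minus_minus diff_minus_eq_add uminus_add_conv_diff)
  qed
  finally show "conv c d (- k) = conv c d k" by (simp add: conv_def)
qed

lemma odd_supp_cube:
  assumes "odd_supp c"
  shows "odd_supp (conv (conv c c) c)"
  unfolding odd_supp_def
proof (intro allI impI)
  fix k :: int assume k: "even k"
  have *: "conv c c n = 0" if "odd n" for n
    unfolding conv_def
  proof (rule infsum_0)
    fix m show "c m * c (n - m) = 0"
      using assms that by (cases "even m") (auto simp: odd_supp_def)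
  qed
  show "conv (conv c c) c k = 0"
    unfolding conv_def[of "conv c c"]
  proof (rule infsum_0)
    fix n show "conv c c n * c (k - n) = 0"
      using * assms k by (cases "even n") (auto simp: odd_supp_def)
  qed
qed

lemma summable_cos_series: "wbound B c \<Longrightarrow> (\<lambda>n. c n * cos (freq n * z)) summable_on UNIV"
  by (rule wbound_summable) auto

lemma summable_sin_series: "wbound B c \<Longrightarrow> (\<lambda>n. c n * sin (freq n * z)) summable_on UNIV"
  by (rule wbound_summable) auto

lemma sin_series_eq_0:
  assumes "even_seq c"
  shows "(\<Sum>\<^sub>\<infinity>n. c n * sin (freq n * z)) = 0"
proof -
  have "(\<Sum>\<^sub>\<infinity>n. c n * sin (freq n * z)) = (\<Sum>\<^sub>\<infinity>n. c (- n) * sin (freq (- n) * z))"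
    by (rule infsum_reindex_bij_betw[OF bij_uminus, symmetric])
  also have "\<dots> = (\<Sum>\<^sub>\<infinity>n. - (c n * sin (freq n * z)))"
    using assms by (simp add: even_seq_def freq_def)
  also have "\<dots> = - (\<Sum>\<^sub>\<infinity>n. c n * sin (freq n * z))" by (rule infsum_uminus)
  finally show ?thesis by simp
qed

lemma cos_freq_1: "odd n \<Longrightarrow> cos (freq n) = 0"
  unfolding freq_def cos_zero_iff_int by (metis mult.commute)

lemma cos_series_1:
  assumes "odd_supp c"
  shows "cos_series c 1 = 0"
  unfolding cos_series_def
proof (rule infsum_0)
  fix n show "c n * cos (freq n * 1) = 0"
    using assms cos_freq_1[of n] by (cases "even n") (auto simp: odd_supp_def)
qed

lemma cos_series_mult:
  assumes c: "wbound A c" and d: "wbound B d" and "even_seq d"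
  shows "cos_series c z * cos_series d z = cos_series (conv c d) z"
proof -
  define h where "h = (\<lambda>(n, m). c n * d m * cos (freq (n + m) * z))"
  have A: "A \<ge> 0" and B: "B \<ge> 0" using c d wbound_nonneg by auto
  define W where "W = (\<lambda>(n, m). (A * wt n) * (B * wt m))"
  have "(\<lambda>p. norm (W p)) summable_on UNIV \<times> UNIV"
    unfolding Infinite_Sum.abs_summable_on_Sigma_iff
  proof (intro conjI ballI)
    have *: "norm (W (n, m)) = (A * wt n) * (B * wt m)" for n m
      using A B wt_pos[of n] wt_pos[of m] by (simp add: abs_mult W_def)
    show "(\<lambda>m. norm (W (n, m))) summable_on UNIV" for n
      unfolding * by (intro summable_on_cmult_right summable_wt)
    have "norm (\<Sum>\<^sub>\<infinity>m. norm (W (n, m))) = A * wt n * (B * infsum wt UNIV)" for n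
      unfolding * infsum_cmult_right'
      using A B wt_pos by (simp add: abs_mult infsum_nonneg less_imp_le)
    then show "(\<lambda>n. norm (\<Sum>\<^sub>\<infinity>m. norm (W (n, m)))) summable_on UNIV"
      by (simp only:) (intro summable_on_cmult_right summable_on_cmult_left summable_wt)
  qed
  then have "W summable_on UNIV \<times> UNIV"
    by (rule abs_summable_summable)
  then have h: "h summable_on UNIV \<times> UNIV"
  proof (rule summable_on_majorant)
    fix p :: "int \<times> int"
    obtain n m where p: "p = (n, m)" by fastforce
    have "\<bar>c n * d m * cos (freq (n + m) * z)\<bar> \<le> \<bar>c n\<bar> * \<bar>d m\<bar>"
      by (simp add: abs_mult mult_left_le)
    also have "\<dots> \<le> (A * wt n) * (B * wt m)"
      by (intro mult_mono wboundD c d) (use A wt_pos[of n] in auto)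
    finally show "\<bar>h p\<bar> \<le> W p"
      by (simp add: h_def W_def p)
  qed
  have "infsum h (UNIV \<times> UNIV) = (\<Sum>\<^sub>\<infinity>n. \<Sum>\<^sub>\<infinity>m. h (n, m))"
    by (rule infsum_Sigma_banach[OF h, symmetric])
  also have "\<dots> = (\<Sum>\<^sub>\<infinity>n. c n * cos (freq n * z) * cos_series d z)"
  proof (rule infsum_cong)
    fix n
    have "(\<Sum>\<^sub>\<infinity>m. h (n, m)) = (\<Sum>\<^sub>\<infinity>m. (c n * cos (freq n * z)) * (d m * cos (freq m * z))
        + (- c n * sin (freq n * z)) * (d m * sin (freq m * z)))"
    proof (rule infsum_cong)
      fix m
      have "freq (n + m) * z = freq n * z + freq m * z" by (simp add: freq_def algebra_simps)
      then show "h (n, m) = (c n * cos (freq n * z)) * (d m * cos (freq m * z))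
          + (- c n * sin (freq n * z)) * (d m * sin (freq m * z))"
        by (simp add: h_def cos_add algebra_simps)
    qed
    also have "\<dots> = (c n * cos (freq n * z)) * cos_series d z"
      unfolding cos_series_def
      by (subst infsum_add)
        (auto simp only: infsum_cmult_right' sin_series_eq_0[OF \<open>even_seq d\<close>] mult_zero_right add_0_right
          intro!: summable_on_cmult_right summable_cos_series[OF d] summable_sin_series[OF d])
    finally show "(\<Sum>\<^sub>\<infinity>m. h (n, m)) = c n * cos (freq n * z) * cos_series d z" .
  qed
  also have "\<dots> = cos_series c z * cos_series d z"
    by (simp add: infsum_cmult_left' cos_series_def)
  finally have 1: "infsum h (UNIV \<times> UNIV) = cos_series c z * cos_series d z" .
  let ?k = "\<lambda>n k. c n * d (k - n) * cos (freq k * z)"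
  have "infsum h (UNIV \<times> UNIV) = infsum (\<lambda>(n, k). ?k n k) (UNIV \<times> UNIV)"
    by (rule infsum_reindex_bij_witness[where j = "\<lambda>(n, m). (n, n + m)" and i = "\<lambda>(n, k). (n, k - n)"])
      (auto simp: h_def)
  moreover have sk: "(\<lambda>(n, k). ?k n k) summable_on UNIV \<times> UNIV"
    using h by (subst (asm) summable_on_reindex_bij_witness[where T = "UNIV \<times> UNIV" and
      h = "\<lambda>(n, k). ?k n k" and j = "\<lambda>(n, m). (n, n + m)" and i = "\<lambda>(n, k). (n, k - n)"])
      (auto simp: h_def)
  moreover have "infsum (\<lambda>(n, k). ?k n k) (UNIV \<times> UNIV) = (\<Sum>\<^sub>\<infinity>n. \<Sum>\<^sub>\<infinity>k. ?k n k)"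
    using infsum_Sigma_banach[OF sk] by simp
  moreover have "\<dots> = (\<Sum>\<^sub>\<infinity>k. \<Sum>\<^sub>\<infinity>n. ?k n k)"
    by (rule infsum_swap_banach[OF sk])
  moreover have "\<dots> = cos_series (conv c d) z"
    by (simp add: cos_series_def conv_def infsum_cmult_left')
  ultimately show ?thesis using 1 by simp
qed

definition sin_deriv_series :: "(int \<Rightarrow> real) \<Rightarrow> real \<Rightarrow> real" where
  "sin_deriv_series c z = (\<Sum>\<^sub>\<infinity>n. - (freq n * c n) * sin (freq n * z))"

lemma wbound_mono:
  assumes "wbound D d" "\<And>n. \<bar>c n\<bar> \<le> \<bar>d n\<bar>"
  shows "wbound D c"
  using assms unfolding wbound_def by (meson order_trans)

lemma freq_le: "\<bar>freq n\<bar> \<le> 1 + (freq n)\<^sup>2"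
proof -
  have "0 \<le> (\<bar>freq n\<bar> - 1 / 2)\<^sup>2 + 3 / 4" by simp
  then show ?thesis by (simp add: power2_eq_square algebra_simps)
qed

lemma wbound_derivs:
  assumes "wbound D (\<lambda>n. (1 + (freq n)\<^sup>2) * c n)"
  shows "wbound D c" "wbound D (\<lambda>n. - (freq n * c n))" "wbound D (\<lambda>n. - ((freq n)\<^sup>2 * c n))"
proof -
  have *: "\<bar>a\<bar> * \<bar>c n\<bar> \<le> (1 + (freq n)\<^sup>2) * \<bar>c n\<bar>" if "\<bar>a\<bar> \<le> 1 + (freq n)\<^sup>2" for a n
    using that by (rule mult_right_mono) simp
  show "wbound D c" by (rule wbound_mono[OF assms]) (use *[of 1] in \<open>auto simp: abs_mult\<close>)
  show "wbound D (\<lambda>n. - (freq n * c n))"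
    by (rule wbound_mono[OF assms]) (use *[OF freq_le] in \<open>auto simp: abs_mult\<close>)
  show "wbound D (\<lambda>n. - ((freq n)\<^sup>2 * c n))"
    by (rule wbound_mono[OF assms]) (use *[of "(freq n)\<^sup>2" n for n] in \<open>auto simp: abs_mult\<close>)
qed

lemma wbound_times_trig:
  assumes "wbound D c" "\<bar>e\<bar> \<le> 1"
  shows "\<bar>c n * e\<bar> \<le> D * wt n"
  using mult_mono[OF wboundD[OF assms(1), of n] assms(2)] wbound_nonneg[OF assms(1)] wt_pos[of n]
  by (simp add: abs_mult)

lemma continuous_on_cos_series:
  fixes c :: "real \<Rightarrow> int \<Rightarrow> real"
  assumes "\<And>n. continuous_on A (\<lambda>t. c t n)" "\<And>t. t \<in> A \<Longrightarrow> wbound D (c t)"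
  shows "continuous_on (A \<times> B) (\<lambda>(t, z). cos_series (c t) z)"
  unfolding cos_series_def case_prod_beta
proof (rule continuous_on_infsum[OF summable_Bwt])
  show "\<bar>c (fst p) n * cos (freq n * snd p)\<bar> \<le> D * wt n" if "p \<in> A \<times> B" for n p
    using assms(2) that by (intro wbound_times_trig) auto
  show "continuous_on (A \<times> B) (\<lambda>p. c (fst p) n * cos (freq n * snd p))" for n
  proof (intro continuous_on_mult)
    show "continuous_on (A \<times> B) (\<lambda>p. c (fst p) n)"
      by (rule continuous_on_compose2[OF assms(1) continuous_on_fst[OF continuous_on_id]]) auto
    show "continuous_on (A \<times> B) (\<lambda>p. cos (freq n * snd p))"
      by (rule continuous_on_cos) (intro continuous_intros)
  qed
qed

lemma continuous_on_sin_deriv_series: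
  fixes c :: "real \<Rightarrow> int \<Rightarrow> real"
  assumes "\<And>n. continuous_on A (\<lambda>t. c t n)"
    and "\<And>t. t \<in> A \<Longrightarrow> wbound D (\<lambda>n. (1 + (freq n)\<^sup>2) * c t n)"
  shows "continuous_on (A \<times> B) (\<lambda>(t, z). sin_deriv_series (c t) z)"
  unfolding sin_deriv_series_def case_prod_beta
proof (rule continuous_on_infsum[OF summable_Bwt])
  show "\<bar>- (freq n * c (fst p) n) * sin (freq n * snd p)\<bar> \<le> D * wt n" if "p \<in> A \<times> B" for n p
    using that by (intro wbound_times_trig[of _ "\<lambda>n. - (freq n * c (fst p) n)"] wbound_derivs(2)[OF assms(2)]) auto
  show "continuous_on (A \<times> B) (\<lambda>p. - (freq n * c (fst p) n) * sin (freq n * snd p))" for n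
  proof (intro continuous_on_mult continuous_on_minus continuous_on_const)
    show "continuous_on (A \<times> B) (\<lambda>p. c (fst p) n)"
      by (rule continuous_on_compose2[OF assms(1) continuous_on_fst[OF continuous_on_id]]) auto
    show "continuous_on (A \<times> B) (\<lambda>p. sin (freq n * snd p))"
      by (rule continuous_on_sin) (intro continuous_intros)
  qed
qed

lemma has_derivative_cos_series:
  assumes "wbound D (\<lambda>n. (1 + (freq n)\<^sup>2) * c n)"
  shows "(cos_series c has_real_derivative sin_deriv_series c z) (at z)"
  unfolding cos_series_def[abs_def] sin_deriv_series_def
proof (rule has_real_derivative_infsum[OF summable_Bwt _ summable_Bwt, where S = UNIV])
  show "((\<lambda>z. c n * cos (freq n * z)) has_real_derivative - (freq n * c n) * sin (freq n * z)) (at z)" for n z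
    by (auto intro!: derivative_eq_intros)
  show "\<bar>c n * cos (freq n * y)\<bar> \<le> D * wt n" for n y
    by (intro wbound_times_trig wbound_derivs[OF assms]) auto
  show "\<bar>- (freq n * c n) * sin (freq n * y)\<bar> \<le> D * wt n" for n y
    by (intro wbound_times_trig[of _ "\<lambda>n. - (freq n * c n)"] wbound_derivs[OF assms]) auto
qed (auto intro!: continuous_intros)

lemma has_derivative_sin_deriv_series:
  assumes "wbound D (\<lambda>n. (1 + (freq n)\<^sup>2) * c n)"
  shows "(sin_deriv_series c has_real_derivative cos_series (\<lambda>n. - ((freq n)\<^sup>2 * c n)) z) (at z)"
  unfolding sin_deriv_series_def[abs_def] cos_series_def
proof (rule has_real_derivative_infsum[OF summable_Bwt _ summable_Bwt, where S = UNIV])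
  show "((\<lambda>z. - (freq n * c n) * sin (freq n * z)) has_real_derivative
      - ((freq n)\<^sup>2 * c n) * cos (freq n * z)) (at z)" for n z
    by (auto intro!: derivative_eq_intros simp: power2_eq_square)
  show "\<bar>- (freq n * c n) * sin (freq n * y)\<bar> \<le> D * wt n" for n y
    by (intro wbound_times_trig[of _ "\<lambda>n. - (freq n * c n)"] wbound_derivs[OF assms]) auto
  show "\<bar>- ((freq n)\<^sup>2 * c n) * cos (freq n * y)\<bar> \<le> D * wt n" for n y
    by (intro wbound_times_trig[of _ "\<lambda>n. - ((freq n)\<^sup>2 * c n)"] wbound_derivs[OF assms]) auto
qed (auto intro!: continuous_intros)

lemma cos_series_cmult: "cos_series (\<lambda>n. b * c n) z = b * cos_series c z"
  by (simp add: cos_series_def mult.assoc infsum_cmult_right')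

lemma cos_series_add:
  assumes "wbound C c" "wbound D d"
  shows "cos_series (\<lambda>n. c n + d n) z = cos_series c z + cos_series d z"
  unfolding cos_series_def distrib_right
  by (intro infsum_add summable_cos_series[OF assms(1)] summable_cos_series[OF assms(2)])

lemma cos_series_diff:
  assumes "wbound C c" "wbound D d"
  shows "cos_series (\<lambda>n. c n - d n) z = cos_series c z - cos_series d z"
proof -
  have "wbound D (\<lambda>n. -1 * d n)" using assms(2) by (simp add: wbound_def)
  from cos_series_add[OF assms(1) this] show ?thesis
    by (simp only: cos_series_cmult) simp
qed

lemma wbound_add:
  assumes "wbound C c" "wbound D d"
  shows "wbound (C + D) (\<lambda>n. c n + d n)"
  using assms unfolding wbound_def distrib_right
  by (meson abs_triangle_ineq add_mono order_trans)

lemma wbound_cmult: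
  assumes "wbound C c"
  shows "wbound (\<bar>b\<bar> * C) (\<lambda>n. b * c n)"
  using assms unfolding wbound_def by (simp add: abs_mult mult.assoc mult_left_mono)

lemma wbound_diff:
  assumes "wbound C c" "wbound D d"
  shows "wbound (C + D) (\<lambda>n. c n - d n)"
  using wbound_add[OF assms(1) wbound_cmult[OF assms(2), of "-1"]] by simp

section \<open>The linear problem\<close>

locale linear_modes =
  fixes \<mu> K :: real and c g :: "real \<Rightarrow> int \<Rightarrow> real" and D G :: real
  assumes mu_pos: "\<mu> > 0" and K_pos: "K > 0"
    and cont_c: "\<And>n. continuous_on {0..} (\<lambda>t. c t n)"
    and deriv_c: "\<And>t n. t > 0 \<Longrightarrow>
      ((\<lambda>s. c s n) has_real_derivative - (\<mu> * (freq n)\<^sup>2 + K) * c t n + g t n) (at t)"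
    and cont_g: "\<And>n. continuous_on {0..} (\<lambda>t. g t n)"
    and c_bound: "\<And>t. t \<ge> 0 \<Longrightarrow> wbound D (\<lambda>n. (1 + (freq n)\<^sup>2) * c t n)"
    and g_bound: "\<And>t. t \<ge> 0 \<Longrightarrow> wbound G (g t)"
begin

lemmas c_bounds = wbound_derivs[OF c_bound]

definition c' :: "real \<Rightarrow> int \<Rightarrow> real" where
  "c' t n = - (\<mu> * (freq n)\<^sup>2 + K) * c t n + g t n"

lemma c'_eq: "c' t = (\<lambda>n. (\<mu> * - ((freq n)\<^sup>2 * c t n) + (- K) * c t n) + g t n)"
  by (auto simp: c'_def algebra_simps)

lemma c'_bound: "t \<ge> 0 \<Longrightarrow> wbound (\<bar>\<mu>\<bar> * D + \<bar>- K\<bar> * D + G) (c' t)"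
  unfolding c'_eq by (intro wbound_add wbound_cmult c_bounds g_bound)

lemma cos_series_c':
  assumes "t \<ge> 0"
  shows "cos_series (c' t) z =
    \<mu> * cos_series (\<lambda>n. - ((freq n)\<^sup>2 * c t n)) z - K * cos_series (c t) z + cos_series (g t) z"
proof -
  note b = wbound_cmult[OF c_bounds(3)[OF assms], of \<mu>] wbound_cmult[OF c_bounds(1)[OF assms], of "- K"]
  show ?thesis
    unfolding c'_eq cos_series_add[OF wbound_add[OF b] g_bound[OF assms]] cos_series_add[OF b]
      cos_series_cmult
    by simp
qed

lemma cont_c': "continuous_on {0..} (\<lambda>t. c' t n)"
  unfolding c'_def by (intro continuous_intros cont_c cont_g)

lemma time_deriv:
  assumes "t > 0"
  shows "((\<lambda>s. cos_series (c s) z) has_real_derivative cos_series (c' t) z) (at t)"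
  unfolding cos_series_def
proof (rule has_real_derivative_infsum[OF summable_Bwt _ summable_Bwt, where S = "{0<..}"])
  show "((\<lambda>s. c s n * cos (freq n * z)) has_real_derivative c' s n * cos (freq n * z)) (at s)"
    if "s \<in> {0<..}" for n s
    using deriv_c[of s n] that by (auto simp: c'_def intro!: derivative_eq_intros)
  show "\<bar>c s n * cos (freq n * z)\<bar> \<le> D * wt n" if "s \<in> {0<..}" for n s
    using that by (intro wbound_times_trig c_bounds) auto
  show "\<bar>c' s n * cos (freq n * z)\<bar> \<le> (\<bar>\<mu>\<bar> * D + \<bar>- K\<bar> * D + G) * wt n" if "s \<in> {0<..}" for n s
    using that by (intro wbound_times_trig c'_bound) auto
  show "continuous_on {0<..} (\<lambda>s. c' s n * cos (freq n * z))" for n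
    by (intro continuous_intros continuous_on_subset[OF cont_c']) auto
qed (use assms in auto)

lemma space_deriv:
  "t \<ge> 0 \<Longrightarrow> (cos_series (c t) has_real_derivative sin_deriv_series (c t) z) (at z)"
  "t \<ge> 0 \<Longrightarrow> (sin_deriv_series (c t) has_real_derivative
     cos_series (\<lambda>n. - ((freq n)\<^sup>2 * c t n)) z) (at z)"
  by (rule has_derivative_cos_series has_derivative_sin_deriv_series, rule c_bound, assumption)+

lemma continuous_solution:
  "continuous_on ({0..} \<times> B) (\<lambda>(t, z). cos_series (c t) z)"
  "continuous_on ({0..} \<times> B) (\<lambda>(t, z). cos_series (c' t) z)"
  "continuous_on ({0..} \<times> B) (\<lambda>(t, z). sin_deriv_series (c t) z)"
  "continuous_on ({0..} \<times> B) (\<lambda>(t, z). cos_series (\<lambda>n. - ((freq n)\<^sup>2 * c t n)) z)"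
  by (rule continuous_on_cos_series continuous_on_sin_deriv_series;
      auto intro!: continuous_intros cont_c cont_c' c_bounds c'_bound c_bound)+

lemma solution_ge:
  assumes M: "M \<ge> 0"
    and supp: "\<And>t. t \<ge> 0 \<Longrightarrow> odd_supp (c t)"
    and init: "\<And>z. \<bar>z\<bar> \<le> 1 \<Longrightarrow> cos_series (c 0) z \<ge> - M"
    and source: "\<And>t z. t > 0 \<Longrightarrow> \<bar>z\<bar> < 1 \<Longrightarrow> cos_series (g t) z \<ge> - (K * M)"
    and "t \<ge> 0" "\<bar>z\<bar> \<le> 1"
  shows "cos_series (c t) z \<ge> - M"
proof -
  have minus: "cos_series (c s) (- 1) = cos_series (c s) 1" for s
    by (simp add: cos_series_def)
  have "cos_series (c t) z + M \<ge> 0"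
  proof (rule comparison_principle[where \<mu> = \<mu> and K = K and v = "\<lambda>t z. cos_series (c t) z + M" and vt = "\<lambda>t. cos_series (c' t)"
        and vz = "\<lambda>t. sin_deriv_series (c t)" and vzz = "\<lambda>t. cos_series (\<lambda>n. - ((freq n)\<^sup>2 * c t n))"])
    show "continuous_on ({0..} \<times> {- 1..1}) (\<lambda>(t, z). cos_series (c t) z + M)"
      using continuous_solution(1) by (auto simp: case_prod_beta intro!: continuous_intros)
    show "\<mu> * cos_series (\<lambda>n. - ((freq n)\<^sup>2 * c t n)) z - K * (cos_series (c t) z + M) \<le> cos_series (c' t) z"
      if "t > 0" "\<bar>z\<bar> < 1" for t z
      using source[OF that] that by (simp add: cos_series_c' algebra_simps)
    show "0 \<le> cos_series (c 0) z + M" if "\<bar>z\<bar> \<le> 1" for z using init[OF that] by simp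
    show "0 \<le> cos_series (c t) 1 + M" "0 \<le> cos_series (c t) (- 1) + M" if "t > 0" for t
      unfolding minus using that M supp[of t] by (simp_all add: cos_series_1)
    show "((\<lambda>s. cos_series (c s) z + M) has_real_derivative cos_series (c' t) z) (at t)" if "t > 0" for t z
      using time_deriv[OF that] by (auto intro!: derivative_eq_intros)
    show "((\<lambda>z. cos_series (c t) z + M) has_real_derivative sin_deriv_series (c t) z) (at z)" if "t > 0" for t z
      using space_deriv(1)[of t z] that by (auto intro!: derivative_eq_intros)
  qed (use assms mu_pos K_pos space_deriv(2) in auto)
  then show ?thesis by simp
qed

end

lemma linear_modes_diff:
  assumes "linear_modes \<mu> K c g D G" "linear_modes \<mu> K d h D' G'"
  shows "linear_modes \<mu> K (\<lambda>t n. c t n - d t n) (\<lambda>t n. g t n - h t n) (D + D') (G + G')"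
proof -
  interpret c: linear_modes \<mu> K c g D G by fact
  interpret d: linear_modes \<mu> K d h D' G' by fact
  show ?thesis
  proof
    show "wbound (D + D') (\<lambda>n. (1 + (freq n)\<^sup>2) * (c t n - d t n))" if "t \<ge> 0" for t
      unfolding right_diff_distrib by (intro wbound_diff c.c_bound d.c_bound that)
    show "((\<lambda>s. c s n - d s n) has_real_derivative
        - (\<mu> * (freq n)\<^sup>2 + K) * (c t n - d t n) + (g t n - h t n)) (at t)" if "t > 0" for t n
      using DERIV_diff[OF c.deriv_c[OF that] d.deriv_c[OF that], of n n]
      by (simp add: algebra_simps)
  qed (use c.mu_pos c.K_pos in \<open>auto intro!: continuous_intros c.cont_c c.cont_g d.cont_c d.cont_g wbound_diff c.g_bound d.g_bound\<close>)
qed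

lemma linear_modes_zero:
  assumes "\<mu> > 0" "K > 0"
  shows "linear_modes \<mu> K (\<lambda>t n. 0) (\<lambda>t n. 0) 0 0"
  using assms by unfold_locales (auto simp: wbound_def)

lemma linear_modes_mono:
  assumes c: "linear_modes \<mu> K c g D G" and d: "linear_modes \<mu> K d h D' G'"
    and supp: "\<And>t. t \<ge> 0 \<Longrightarrow> odd_supp (c t)" "\<And>t. t \<ge> 0 \<Longrightarrow> odd_supp (d t)"
    and init: "\<And>z. \<bar>z\<bar> \<le> 1 \<Longrightarrow> cos_series (c 0) z \<le> cos_series (d 0) z"
    and source: "\<And>t z. t > 0 \<Longrightarrow> \<bar>z\<bar> < 1 \<Longrightarrow> cos_series (g t) z \<le> cos_series (h t) z"
    and "t \<ge> 0" "\<bar>z\<bar> \<le> 1"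
  shows "cos_series (c t) z \<le> cos_series (d t) z"
proof -
  interpret c: linear_modes \<mu> K c g D G by fact
  interpret d: linear_modes \<mu> K d h D' G' by fact
  interpret e: linear_modes \<mu> K "\<lambda>t n. d t n - c t n" "\<lambda>t n. h t n - g t n" "D' + D" "G' + G"
    by (rule linear_modes_diff[OF d c])
  have eq: "cos_series (\<lambda>n. d t n - c t n) z = cos_series (d t) z - cos_series (c t) z"
    "cos_series (\<lambda>n. h t n - g t n) z = cos_series (h t) z - cos_series (g t) z" if "t \<ge> 0" for t z
    using that by (auto intro!: cos_series_diff c.c_bounds d.c_bounds c.g_bound d.g_bound)
  have "- 0 \<le> cos_series (\<lambda>n. d t n - c t n) z"
    by (rule e.solution_ge) (use assms eq in \<open>auto simp: odd_supp_def\<close>)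
  then show ?thesis using eq \<open>t \<ge> 0\<close> by simp
qed

lemma linear_modes_le:
  assumes c: "linear_modes \<mu> K c g D G" and M: "M \<ge> 0"
    and supp: "\<And>t. t \<ge> 0 \<Longrightarrow> odd_supp (c t)"
    and init: "\<And>z. \<bar>z\<bar> \<le> 1 \<Longrightarrow> cos_series (c 0) z \<le> M"
    and source: "\<And>t z. t > 0 \<Longrightarrow> \<bar>z\<bar> < 1 \<Longrightarrow> cos_series (g t) z \<le> K * M"
    and "t \<ge> 0" "\<bar>z\<bar> \<le> 1"
  shows "cos_series (c t) z \<le> M"
proof -
  interpret c: linear_modes \<mu> K c g D G by fact
  interpret e: linear_modes \<mu> K "\<lambda>t n. 0 - c t n" "\<lambda>t n. 0 - g t n" "0 + D" "0 + G"
    by (rule linear_modes_diff[OF linear_modes_zero c]) (rule c.mu_pos c.K_pos)+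
  have eq: "cos_series (\<lambda>n. 0 - f n) z = - cos_series f z" for f z
    using cos_series_cmult[of "-1" f z] by simp
  have "- M \<le> cos_series (\<lambda>n. 0 - c t n) z"
    by (rule e.solution_ge) (use assms in \<open>auto simp: odd_supp_def eq[simplified]\<close>)
  then show ?thesis unfolding eq by simp
qed

definition duhamel :: "real \<Rightarrow> real \<Rightarrow> (int \<Rightarrow> real) \<Rightarrow> (real \<Rightarrow> int \<Rightarrow> real) \<Rightarrow> real \<Rightarrow> int \<Rightarrow> real" where
  "duhamel \<mu> K c0 g t n = exp (- (\<mu> * (freq n)\<^sup>2 + K) * t) *
     (c0 n + integral {0..t} (\<lambda>s. exp ((\<mu> * (freq n)\<^sup>2 + K) * s) * g s n))"

lemma continuous_on_atLeast:
  fixes f :: "real \<Rightarrow> real"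
  assumes "\<And>b. continuous_on {0..b} f"
  shows "continuous_on {0..} f"
  unfolding continuous_on_eq_continuous_within
proof
  fix t :: real assume "t \<in> {0..}"
  then have "continuous (at t within {0..t+1}) f"
    using assms[of "t + 1"] by (simp add: continuous_on_eq_continuous_within)
  moreover have "at t within {0..t+1} = at t within {0..}"
    by (rule at_within_nhd[of _ "{..<t+1}"]) auto
  ultimately show "continuous (at t within {0..}) f" by simp
qed

lemma duhamel_0 [simp]: "duhamel \<mu> K c0 g 0 n = c0 n"
  by (simp add: duhamel_def)

lemma continuous_on_duhamel:
  assumes "\<And>t. (\<lambda>s. exp ((\<mu> * (freq n)\<^sup>2 + K) * s) * g s n) integrable_on {0..t}"
  shows "continuous_on {0..} (\<lambda>t. duhamel \<mu> K c0 g t n)"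
  unfolding duhamel_def
  by (intro continuous_intros continuous_on_atLeast indefinite_integral_continuous_1 assms)

lemma duhamel_deriv:
  assumes g: "continuous_on {0..} (\<lambda>t. g t n)" and t: "t > 0"
  shows "((\<lambda>s. duhamel \<mu> K c0 g s n) has_real_derivative
    - (\<mu> * (freq n)\<^sup>2 + K) * duhamel \<mu> K c0 g t n + g t n) (at t)"
proof -
  define \<rho> where "\<rho> = \<mu> * (freq n)\<^sup>2 + K"
  have "((\<lambda>t. integral {0..t} (\<lambda>s. exp (\<rho> * s) * g s n)) has_real_derivative exp (\<rho> * t) * g t n)
      (at t within {0..t+1})"
    by (rule integral_has_real_derivative)
      (use t in \<open>auto intro!: continuous_intros continuous_on_subset[OF g]\<close>)
  then have "((\<lambda>t. integral {0..t} (\<lambda>s. exp (\<rho> * s) * g s n)) has_real_derivative exp (\<rho> * t) * g t n) (at t)"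
    using t by (simp add: at_within_Icc_at)
  then have "((\<lambda>t. exp (- \<rho> * t) * (c0 n + integral {0..t} (\<lambda>s. exp (\<rho> * s) * g s n)))
      has_real_derivative - \<rho> * (exp (- \<rho> * t) * (c0 n + integral {0..t} (\<lambda>s. exp (\<rho> * s) * g s n)))
        + exp (- \<rho> * t) * (exp (\<rho> * t) * g t n)) (at t)"
    by (auto intro!: derivative_eq_intros simp: algebra_simps)
  then show ?thesis
    by (simp add: duhamel_def \<rho>_def[symmetric] mult.assoc[symmetric] exp_minus_inverse flip: exp_add)
qed

lemma duhamel_bound:
  assumes "\<mu> > 0" "K > 0" and g: "continuous_on {0..} (\<lambda>t. g t n)" and "t \<ge> 0"
    and P: "\<And>s. s \<ge> 0 \<Longrightarrow> \<bar>g s n\<bar> \<le> P"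
  shows "\<bar>duhamel \<mu> K c0 g t n\<bar> \<le> \<bar>c0 n\<bar> + P / (\<mu> * (freq n)\<^sup>2 + K)"
proof -
  define \<rho> where "\<rho> = \<mu> * (freq n)\<^sup>2 + K"
  define c where "c s = duhamel \<mu> K c0 g s n" for s
  have "\<rho> > 0" using assms by (simp add: \<rho>_def add_nonneg_pos)
  have "P \<ge> 0" using P[of 0] by simp
  have cont: "continuous_on {0..} c" unfolding c_def
    by (intro continuous_on_duhamel integrable_continuous_real continuous_intros continuous_on_subset[OF g]) auto
  have deriv: "(c has_real_derivative - \<rho> * c s + g s n) (at s)" if "s > 0" for s
    using duhamel_deriv[where g = g and n = n and t = s, OF g that] by (simp add: c_def[abs_def] \<rho>_def)
  have e: "0 \<le> exp (- \<rho> * t)" "exp (- \<rho> * t) \<le> 1" using \<open>\<rho> > 0\<close> \<open>t \<ge> 0\<close> by auto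
  have b: "v t \<le> \<bar>c0 n\<bar> + P / \<rho>"
    if v: "continuous_on {0..} v" "\<And>s. s > 0 \<Longrightarrow> (v has_real_derivative - \<rho> * v s + h s) (at s)"
      "\<And>s. s > 0 \<Longrightarrow> h s \<le> P" "v 0 \<le> \<bar>c0 n\<bar>" for v h
  proof -
    have "v t \<le> exp (- \<rho> * t) * v 0 + (1 - exp (- \<rho> * t)) * (P / \<rho>)"
      by (rule exponential_decay_bound[OF \<open>\<rho> > 0\<close> \<open>t \<ge> 0\<close> v(1,2)]) (use v(3) in auto)
    also have "exp (- \<rho> * t) * v 0 \<le> 1 * \<bar>c0 n\<bar>"
      using e v(4) by (meson abs_ge_zero mult_mono mult_left_mono mult_right_mono order_trans)
    also have "(1 - exp (- \<rho> * t)) * (P / \<rho>) \<le> 1 * (P / \<rho>)"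
      using e \<open>P \<ge> 0\<close> \<open>\<rho> > 0\<close> by (intro mult_right_mono) auto
    finally show ?thesis by simp
  qed
  have gP: "g s n \<le> P" "- g s n \<le> P" if "s > 0" for s
    using P[of s] that by (simp_all add: abs_le_iff)
  have "c t \<le> \<bar>c0 n\<bar> + P / \<rho>"
    by (rule b[OF cont deriv gP(1)]) (auto simp: c_def)
  moreover have "- c t \<le> \<bar>c0 n\<bar> + P / \<rho>"
  proof (rule b[of "\<lambda>s. - c s" "\<lambda>s. - g s n"])
    show "((\<lambda>s. - c s) has_real_derivative - \<rho> * - c s + - g s n) (at s)" if "s > 0" for s
      using DERIV_minus[OF deriv[OF that]] by simp
  qed (use gP in \<open>auto simp: c_def intro!: continuous_intros cont[unfolded c_def]\<close>)
  ultimately show ?thesis by (simp add: c_def \<rho>_def abs_le_iff)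
qed

lemma linear_modes_duhamel:
  assumes "\<mu> > 0" "K > 0" and g: "\<And>n. continuous_on {0..} (\<lambda>t. g t n)"
    and G: "\<And>t. t \<ge> 0 \<Longrightarrow> wbound G (g t)" and E: "wbound E (\<lambda>n. (1 + (freq n)\<^sup>2) * c0 n)"
  shows "linear_modes \<mu> K (duhamel \<mu> K c0 g) g (E + G / min \<mu> K) G"
proof
  show "continuous_on {0..} (\<lambda>t. duhamel \<mu> K c0 g t n)" for n
    by (intro continuous_on_duhamel integrable_continuous_real continuous_intros continuous_on_subset[OF g]) auto
  show "((\<lambda>s. duhamel \<mu> K c0 g s n) has_real_derivative
    - (\<mu> * (freq n)\<^sup>2 + K) * duhamel \<mu> K c0 g t n + g t n) (at t)" if "t > 0" for t n
    by (rule duhamel_deriv[OF g that])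
  show "wbound (E + G / min \<mu> K) (\<lambda>n. (1 + (freq n)\<^sup>2) * duhamel \<mu> K c0 g t n)" if "t \<ge> 0" for t
    unfolding wbound_def
  proof
    fix n
    define q where "q = 1 + (freq n)\<^sup>2"
    define \<kappa> where "\<kappa> = min \<mu> K"
    define \<rho> where "\<rho> = \<mu> * (freq n)\<^sup>2 + K"
    have pos: "q > 0" "\<kappa> > 0" using assms by (auto simp: q_def \<kappa>_def add_pos_nonneg)
    have "\<kappa> * (freq n)\<^sup>2 \<le> \<mu> * (freq n)\<^sup>2" by (rule mult_right_mono) (auto simp: \<kappa>_def)
    then have \<rho>: "\<kappa> * q \<le> \<rho>" by (simp add: \<rho>_def \<kappa>_def q_def algebra_simps)
    with pos have "\<rho> > 0" using mult_pos_pos by (meson less_le_trans)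
    have "G \<ge> 0" using G[of 0] wbound_nonneg by auto
    have "\<bar>duhamel \<mu> K c0 g t n\<bar> \<le> \<bar>c0 n\<bar> + G * wt n / \<rho>"
      unfolding \<rho>_def using assms that by (intro duhamel_bound) (auto simp: wbound_def)
    also have "G * wt n / \<rho> \<le> G * wt n / (\<kappa> * q)"
      using \<rho> pos \<open>G \<ge> 0\<close> wt_pos[of n] by (intro divide_left_mono) (auto intro: mult_pos_pos \<open>\<rho> > 0\<close>)
    finally have "q * \<bar>duhamel \<mu> K c0 g t n\<bar> \<le> q * (\<bar>c0 n\<bar> + G * wt n / (\<kappa> * q))"
      using pos by (intro mult_left_mono) auto
    also have "\<dots> = q * \<bar>c0 n\<bar> + G / \<kappa> * wt n" using pos by (simp add: field_simps)
    also have "q * \<bar>c0 n\<bar> \<le> E * wt n" using wboundD[OF E, of n] pos by (simp add: q_def abs_mult)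
    finally have "q * \<bar>duhamel \<mu> K c0 g t n\<bar> \<le> (E + G / \<kappa>) * wt n"
      by (simp add: distrib_right)
    moreover have "\<bar>q * duhamel \<mu> K c0 g t n\<bar> = q * \<bar>duhamel \<mu> K c0 g t n\<bar>"
      using pos by (simp add: abs_mult)
    ultimately show "\<bar>(1 + (freq n)\<^sup>2) * duhamel \<mu> K c0 g t n\<bar> \<le> (E + G / min \<mu> K) * wt n"
      by (simp only: q_def \<kappa>_def)
  qed
qed (use assms in auto)

section \<open>Cosine coefficients\<close>

lemma infsum_pair:
  fixes f :: "int \<Rightarrow> real"
  assumes "m \<noteq> 0" "\<And>n. n \<noteq> m \<Longrightarrow> n \<noteq> - m \<Longrightarrow> f n = 0"
  shows "(\<Sum>\<^sub>\<infinity>n. f n) = f m + f (- m)"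
proof -
  have "infsum f UNIV = infsum f {m, - m}"
    by (rule infsum_cong_neutral) (use assms in auto)
  then show ?thesis using assms by simp
qed

lemma integral_cos_even:
  assumes "even k"
  shows "integral {0..1} (\<lambda>z. cos (freq k * z)) = (if k = 0 then 1 else 0)"
proof (cases "k = 0")
  case True
  then show ?thesis by (simp add: freq_def)
next
  case False
  obtain j where j: "k = 2 * j" using assms by blast
  have fz: "freq k \<noteq> 0" using False by (simp add: freq_def)
  have "((\<lambda>z. cos (freq k * z)) has_integral sin (freq k * 1) / freq k - sin (freq k * 0) / freq k) {0..1}"
    using fz by (intro fundamental_theorem_of_calculus)
      (auto intro!: derivative_eq_intros simp: has_real_derivative_iff_has_vector_derivative[symmetric])
  moreover have "sin (freq k) = 0"
    by (simp add: freq_def j sin_zero_iff_int2)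
  ultimately show ?thesis using False by (simp add: integral_unique)
qed

lemma integral_cos_cos:
  assumes "odd n" "odd m"
  shows "integral {0..1} (\<lambda>z. cos (freq n * z) * cos (freq m * z)) =
    ((if n = m then 1 else 0) + (if n = - m then 1 else 0)) / 2"
proof -
  have eq: "cos (freq n * z) * cos (freq m * z) = (cos (freq (n - m) * z) + cos (freq (n + m) * z)) / 2" for z
  proof -
    have "freq (n - m) * z = freq n * z - freq m * z" "freq (n + m) * z = freq n * z + freq m * z"
      by (simp_all add: freq_def distrib_right left_diff_distrib add_divide_distrib diff_divide_distrib)
    then show ?thesis by (simp add: cos_times_cos)
  qed
  have "integral {0..1} (\<lambda>z. cos (freq n * z) * cos (freq m * z)) =
      (integral {0..1} (\<lambda>z. cos (freq (n - m) * z)) + integral {0..1} (\<lambda>z. cos (freq (n + m) * z))) / 2"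
    unfolding eq by (simp, subst integral_add) (auto intro!: integrable_continuous_real continuous_intros)
  then show ?thesis
    using assms by (simp add: integral_cos_even eq_neg_iff_add_eq_0)
qed

lemma continuous_on_cos_series_space: "wbound B c \<Longrightarrow> continuous_on S (cos_series c)"
  using continuous_on_slice[OF continuous_on_cos_series[of "{0}" "\<lambda>_. c" B S]]
  by auto

lemma coeff_eq_integral:
  assumes c: "wbound B c" "even_seq c" "odd_supp c" and m: "odd m"
  shows "c m = integral {0..1} (\<lambda>z. cos_series c z * cos (freq m * z))"
proof -
  have "((\<lambda>n. integral {0..1} (\<lambda>z. c n * (cos (freq n * z) * cos (freq m * z)))) has_sum
      integral {0..1} (\<lambda>z. \<Sum>\<^sub>\<infinity>n. c n * (cos (freq n * z) * cos (freq m * z)))) UNIV"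
  proof (rule has_sum_integral[OF summable_Bwt])
    show "\<bar>c n * (cos (freq n * z) * cos (freq m * z))\<bar> \<le> B * wt n" for n z
      by (rule wbound_times_trig[OF c(1)]) (simp add: abs_mult mult_le_one)
  qed (auto intro!: continuous_intros)
  moreover have "(\<Sum>\<^sub>\<infinity>n. c n * (cos (freq n * z) * cos (freq m * z))) = cos_series c z * cos (freq m * z)" for z
    by (simp add: cos_series_def mult.assoc[symmetric] infsum_cmult_left')
  moreover have "integral {0..1} (\<lambda>z. c n * (cos (freq n * z) * cos (freq m * z))) =
      c n * ((if n = m then 1 else 0) + (if n = - m then 1 else 0)) / 2" for n
    using integral_cos_cos[OF _ m, of n] c(3) by (cases "even n") (auto simp: odd_supp_def)
  ultimately have "((\<lambda>n. c n * ((if n = m then 1 else 0) + (if n = - m then 1 else 0)) / 2) has_sum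
      integral {0..1} (\<lambda>z. cos_series c z * cos (freq m * z))) UNIV"
    by (simp only:)
  then have "integral {0..1} (\<lambda>z. cos_series c z * cos (freq m * z)) =
      (\<Sum>\<^sub>\<infinity>n. c n * ((if n = m then 1 else 0) + (if n = - m then 1 else 0)) / 2)"
    by (rule infsumI[symmetric])
  also have "\<dots> = c m / 2 + c (- m) / 2"
    using m by (subst infsum_pair[of m]) auto
  finally show ?thesis using c(2) by (simp add: even_seq_def)
qed

lemma coeff_bound:
  assumes c: "wbound B c" "even_seq c" "odd_supp c"
    and P: "\<And>z. z \<in> {0..1} \<Longrightarrow> \<bar>cos_series c z\<bar> \<le> P"
  shows "\<bar>c m\<bar> \<le> P"
proof (cases "even m")
  case True
  then show ?thesis using c(3) P[of 0] by (auto simp: odd_supp_def)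
next
  case False
  have "\<bar>c m\<bar> = norm (integral (cbox 0 1) (\<lambda>z. cos_series c z * cos (freq m * z)))"
    using coeff_eq_integral[OF c False] by simp
  also have "\<dots> \<le> integral (cbox 0 1) (\<lambda>z::real. P)"
  proof (rule integral_norm_bound_integral)
    show "(\<lambda>z. cos_series c z * cos (freq m * z)) integrable_on cbox 0 1"
      using continuous_on_cos_series_space[OF c(1)]
      by (auto intro!: integrable_continuous_real continuous_intros)
    show "norm (cos_series c z * cos (freq m * z)) \<le> P" if "z \<in> cbox 0 1" for z
      using mult_mono[OF P[of z] abs_cos_le_one[of "freq m * z"]] that P[of 0]
      by (auto simp: abs_mult)
  qed auto
  finally show ?thesis by simp
qed

lemma tendsto_conv:
  assumes c: "\<And>j. wbound A (c j)" "\<And>n. (\<lambda>j. c j n) \<longlonglongrightarrow> c' n"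
    and d: "\<And>j. wbound B (d j)" "\<And>n. (\<lambda>j. d j n) \<longlonglongrightarrow> d' n"
  shows "(\<lambda>j. conv (c j) (d j) k) \<longlonglongrightarrow> conv c' d' k"
  unfolding conv_def
proof (rule tendsto_infsum_dominated)
  show "(\<lambda>n. A * B * (2 * wt k * (wt n + wt (k - n)))) summable_on UNIV"
    by (rule has_sum_imp_summable[OF conv_majorant_has_sum])
  show "\<bar>c j n * d j (k - n)\<bar> \<le> A * B * (2 * wt k * (wt n + wt (k - n)))" for j n
    by (rule conv_term_bound[OF c(1) d(1)])
qed (auto intro!: tendsto_mult c d)

lemma continuous_on_conv:
  fixes c d :: "real \<Rightarrow> int \<Rightarrow> real"
  assumes c: "\<And>t. t \<in> S \<Longrightarrow> wbound A (c t)" "\<And>n. continuous_on S (\<lambda>t. c t n)"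
    and d: "\<And>t. t \<in> S \<Longrightarrow> wbound B (d t)" "\<And>n. continuous_on S (\<lambda>t. d t n)"
  shows "continuous_on S (\<lambda>t. conv (c t) (d t) k)"
  unfolding conv_def
proof (rule continuous_on_infsum)
  show "(\<lambda>n. A * B * (2 * wt k * (wt n + wt (k - n)))) summable_on UNIV"
    by (rule has_sum_imp_summable[OF conv_majorant_has_sum])
  show "\<bar>c t n * d t (k - n)\<bar> \<le> A * B * (2 * wt k * (wt n + wt (k - n)))" if "t \<in> S" for t n
    by (rule conv_term_bound[OF c(1)[OF that] d(1)[OF that]])
qed (auto intro!: continuous_on_mult c d)

lemma wbound_limit:
  assumes "\<And>j. wbound B (c j)" "\<And>n. (\<lambda>j. c j n) \<longlonglongrightarrow> c' n"
  shows "wbound B c'"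
  unfolding wbound_def
proof
  fix n show "\<bar>c' n\<bar> \<le> B * wt n"
    by (rule tendsto_upperbound[OF tendsto_rabs[OF assms(2)]]) (auto simp: wboundD[OF assms(1)])
qed

lemma duhamel_even:
  assumes "even_seq c0" "\<And>s. s \<ge> 0 \<Longrightarrow> even_seq (g s)"
  shows "even_seq (duhamel \<mu> K c0 g t)"
  unfolding even_seq_def
proof
  fix n
  have [simp]: "freq (- n) = - freq n" by (simp add: freq_def)
  have "integral {0..t} (\<lambda>s. exp ((\<mu> * (freq n)\<^sup>2 + K) * s) * g s (- n)) =
    integral {0..t} (\<lambda>s. exp ((\<mu> * (freq n)\<^sup>2 + K) * s) * g s n)"
    using assms(2) by (intro integral_cong) (auto simp: even_seq_def)
  then show "duhamel \<mu> K c0 g t (- n) = duhamel \<mu> K c0 g t n"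
    using assms(1) by (simp add: duhamel_def even_seq_def)
qed

lemma duhamel_odd_supp:
  assumes "odd_supp c0" "\<And>s. s \<ge> 0 \<Longrightarrow> odd_supp (g s)"
  shows "odd_supp (duhamel \<mu> K c0 g t)"
  unfolding odd_supp_def
proof (intro allI impI)
  fix n :: int assume n: "even n"
  have "integral {0..t} (\<lambda>s. exp ((\<mu> * (freq n)\<^sup>2 + K) * s) * g s n) = integral {0..t} (\<lambda>s. 0)"
    using assms(2) n by (intro integral_cong) (auto simp: odd_supp_def)
  then show "duhamel \<mu> K c0 g t n = 0"
    using assms(1) n by (simp add: duhamel_def odd_supp_def)
qed

lemma inverse_freq_le_wt: "1 / (1 + (freq n)\<^sup>2) \<le> wt n"
proof -
  have "1 * 1 \<le> (pi / 2) * (pi / 2)" using pi_gt3 by (intro mult_mono) auto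
  then have "(of_int n)\<^sup>2 * 1 \<le> (of_int n)\<^sup>2 * (pi / 2)\<^sup>2"
    by (intro mult_left_mono) (auto simp: power2_eq_square)
  then have "(of_int n)\<^sup>2 \<le> (freq n)\<^sup>2" by (simp only: freq_def power_mult_distrib mult_1_right)
  then show ?thesis unfolding wt_def by (intro divide_left_mono) (auto intro!: mult_pos_pos add_pos_nonneg)
qed

lemma wbound_duhamel:
  assumes "\<mu> > 0" "K > 0" and g: "\<And>n. continuous_on {0..} (\<lambda>t. g t n)" and "t \<ge> 0"
    and P: "\<And>s n. s \<ge> 0 \<Longrightarrow> \<bar>g s n\<bar> \<le> P"
    and E: "wbound E (\<lambda>n. (1 + (freq n)\<^sup>2) * c0 n)"
  shows "wbound (E + P / min \<mu> K) (duhamel \<mu> K c0 g t)"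
  unfolding wbound_def
proof
  fix n
  define \<kappa> where "\<kappa> = min \<mu> K"
  define q where "q = 1 + (freq n)\<^sup>2"
  have pos: "\<kappa> > 0" "q > 0" using assms by (auto simp: \<kappa>_def q_def add_pos_nonneg)
  have "P \<ge> 0" using P[of 0 0] by simp
  have "\<kappa> * (freq n)\<^sup>2 \<le> \<mu> * (freq n)\<^sup>2" by (rule mult_right_mono) (auto simp: \<kappa>_def)
  then have \<rho>: "\<kappa> * q \<le> \<mu> * (freq n)\<^sup>2 + K" by (simp add: \<kappa>_def q_def algebra_simps)
  have "\<bar>duhamel \<mu> K c0 g t n\<bar> \<le> \<bar>c0 n\<bar> + P / (\<mu> * (freq n)\<^sup>2 + K)"
    using assms by (intro duhamel_bound) auto
  also have "\<bar>c0 n\<bar> \<le> E * wt n"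
    using wboundD[OF wbound_derivs(1)[OF E]] .
  also have "P / (\<mu> * (freq n)\<^sup>2 + K) \<le> P / (\<kappa> * q)"
    using \<rho> \<open>P \<ge> 0\<close> mult_pos_pos[OF pos] by (intro divide_left_mono) auto
  also have "\<dots> = P / \<kappa> * (1 / q)" by simp
  also have "\<dots> \<le> P / \<kappa> * wt n"
    unfolding q_def using pos \<open>P \<ge> 0\<close> by (intro mult_left_mono inverse_freq_le_wt) auto
  finally show "\<bar>duhamel \<mu> K c0 g t n\<bar> \<le> (E + P / min \<mu> K) * wt n"
    by (simp add: \<kappa>_def distrib_right)
qed

section \<open>A solution that stays away from zero\<close>

locale unstable =
  fixes \<mu> a \<epsilon> :: real
  assumes mu_pos: "\<mu> > 0" and eps_pos: "\<epsilon> > 0" and eps_le: "\<epsilon>\<^sup>2 \<le> a - \<mu> * pi\<^sup>2 / 4"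
begin

lemma a_pos: "a > 0"
proof -
  have "0 < \<mu> * pi\<^sup>2 / 4" using mu_pos by simp
  moreover have "0 \<le> \<epsilon>\<^sup>2" by simp
  ultimately show ?thesis using eps_le by linarith
qed

abbreviation "K \<equiv> 2 * a"
definition "M = sqrt a"

definition "F v = 3 * a * v - v ^ 3" for v :: real

lemma M_pos: "M > 0" and M_sq: "M\<^sup>2 = a"
  using a_pos by (auto simp: M_def)

lemma eps_le_M: "\<epsilon> \<le> M"
proof -
  have "0 < \<mu> * pi\<^sup>2 / 4" using mu_pos by simp
  then have "\<epsilon>\<^sup>2 \<le> M\<^sup>2" using eps_le M_sq by linarith
  then show ?thesis by (rule power2_le_imp_le) (use M_pos in simp)
qed

lemma F_mono:
  assumes "0 \<le> v" "v \<le> w" "w \<le> M"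
  shows "F v \<le> F w"
proof -
  have "w\<^sup>2 \<le> M\<^sup>2" "v\<^sup>2 \<le> M\<^sup>2"
    using assms by (auto intro!: power_mono)
  moreover have "w * v \<le> M * M" using assms by (intro mult_mono) auto
  ultimately have "0 \<le> (w - v) * (3 * a - (w\<^sup>2 + w * v + v\<^sup>2))"
    using assms M_sq by (intro mult_nonneg_nonneg) (auto simp: power2_eq_square)
  then show ?thesis
    by (simp add: F_def power2_eq_square power3_eq_cube algebra_simps)
qed

lemma F_0: "F 0 = 0" and F_M: "F M = K * M"
  using M_sq by (auto simp: F_def power3_eq_cube power2_eq_square algebra_simps)

lemma F_range:
  assumes "0 \<le> v" "v \<le> M"
  shows "0 \<le> F v" "F v \<le> K * M"
  using F_mono[of 0 v] F_mono[of v M] assms F_0 F_M by auto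

definition seed :: "int \<Rightarrow> real" where
  "seed n = (if n = 1 \<or> n = - 1 then \<epsilon> / 2 else 0)"

definition "E = (1 + (pi / 2)\<^sup>2) * \<epsilon>"

lemma even_seed: "even_seq seed"
  by (auto simp: even_seq_def seed_def)

lemma odd_seed: "odd_supp seed"
  by (auto simp: odd_supp_def seed_def)

lemma freq_sq_seed: "f ((freq n)\<^sup>2) * seed n = f ((pi / 2)\<^sup>2) * seed n"
  by (auto simp: seed_def freq_def)

lemma wbound_seed: "wbound \<epsilon> seed"
  using eps_pos wt_pos by (auto simp: wbound_def seed_def wt_def)

lemma wbound_seed': "wbound E (\<lambda>n. (1 + (freq n)\<^sup>2) * seed n)"
proof -
  have "wbound (\<bar>1 + (pi / 2)\<^sup>2\<bar> * \<epsilon>) (\<lambda>n. (1 + (pi / 2)\<^sup>2) * seed n)"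
    by (rule wbound_cmult[OF wbound_seed])
  moreover have "(\<lambda>n. (1 + (freq n)\<^sup>2) * seed n) = (\<lambda>n. (1 + (pi / 2)\<^sup>2) * seed n)"
    by (rule ext) (rule freq_sq_seed)
  ultimately show ?thesis by (simp add: E_def)
qed

lemma cos_series_seed: "cos_series seed z = \<epsilon> * cos (pi / 2 * z)"
proof -
  have "cos_series seed z = seed 1 * cos (freq 1 * z) + seed (- 1) * cos (freq (- 1) * z)"
    unfolding cos_series_def by (rule infsum_pair) (auto simp: seed_def)
  then show ?thesis by (simp add: seed_def freq_def)
qed

lemma seed_range:
  assumes "\<bar>z\<bar> \<le> 1"
  shows "0 \<le> cos_series seed z" "cos_series seed z \<le> \<epsilon>"
proof -
  have "\<bar>pi / 2 * z\<bar> \<le> pi / 2 * 1"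
    using assms unfolding abs_mult by (intro mult_mono) auto
  then have "0 \<le> cos (pi / 2 * z)" by (intro cos_ge_zero) (auto simp: abs_le_iff)
  then show "0 \<le> cos_series seed z" "cos_series seed z \<le> \<epsilon>"
    using eps_pos by (auto simp: cos_series_seed mult_left_le)
qed

definition nonlin :: "(int \<Rightarrow> real) \<Rightarrow> int \<Rightarrow> real" where
  "nonlin c n = 3 * a * c n - conv (conv c c) c n"

definition nonlin_bound :: "real \<Rightarrow> real" where
  "nonlin_bound B = \<bar>3 * a\<bar> * B + conv_const * (conv_const * B * B) * B"

lemma wbound_nonlin: "wbound B c \<Longrightarrow> wbound (nonlin_bound B) (nonlin c)"
  unfolding nonlin_def[abs_def] nonlin_bound_def
  by (intro wbound_diff wbound_cmult wbound_conv)

lemma cos_series_nonlin: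
  assumes "wbound B c" "even_seq c"
  shows "cos_series (nonlin c) z = F (cos_series c z)"
proof -
  note b = wbound_cmult[OF assms(1), of "3 * a"] wbound_conv[OF wbound_conv[OF assms(1,1)] assms(1)]
  have "cos_series (conv (conv c c) c) z = cos_series c z ^ 3"
    using cos_series_mult[OF wbound_conv[OF assms(1,1)] assms] cos_series_mult[OF assms(1) assms]
    by (simp add: power3_eq_cube)
  then show ?thesis
    unfolding nonlin_def[abs_def] cos_series_diff[OF b] cos_series_cmult F_def by simp
qed

lemma even_nonlin: "even_seq c \<Longrightarrow> even_seq (nonlin c)"
  using even_conv[OF even_conv, of c c c] by (simp add: nonlin_def even_seq_def)

lemma odd_nonlin: "odd_supp c \<Longrightarrow> odd_supp (nonlin c)"
  using odd_supp_cube[of c] by (simp add: nonlin_def odd_supp_def)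

definition "B = E + (K * M) / min \<mu> K"

definition admissible :: "(int \<Rightarrow> real) \<Rightarrow> bool" where
  "admissible c \<longleftrightarrow> even_seq c \<and> odd_supp c \<and> wbound B c \<and>
     (\<forall>z. \<bar>z\<bar> \<le> 1 \<longrightarrow> 0 \<le> cos_series c z \<and> cos_series c z \<le> M)"

lemma admissible_nonlin:
  assumes "admissible c"
  shows "even_seq (nonlin c)" "odd_supp (nonlin c)" "wbound (nonlin_bound B) (nonlin c)"
    and "cos_series (nonlin c) z = F (cos_series c z)"
    and "\<bar>z\<bar> \<le> 1 \<Longrightarrow> 0 \<le> cos_series (nonlin c) z" "\<bar>z\<bar> \<le> 1 \<Longrightarrow> cos_series (nonlin c) z \<le> K * M"
    and "\<bar>nonlin c n\<bar> \<le> K * M"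
proof -
  have c: "even_seq c" "odd_supp c" "wbound B c"
    "\<And>z. \<bar>z\<bar> \<le> 1 \<Longrightarrow> 0 \<le> cos_series c z" "\<And>z. \<bar>z\<bar> \<le> 1 \<Longrightarrow> cos_series c z \<le> M"
    using assms by (auto simp: admissible_def)
  show *: "even_seq (nonlin c)" "odd_supp (nonlin c)" "wbound (nonlin_bound B) (nonlin c)"
    using c even_nonlin odd_nonlin wbound_nonlin by auto
  show eq: "cos_series (nonlin c) z = F (cos_series c z)" for z
    using cos_series_nonlin c by blast
  show r: "0 \<le> cos_series (nonlin c) z" "cos_series (nonlin c) z \<le> K * M" if "\<bar>z\<bar> \<le> 1" for z
    unfolding eq using F_range c(4,5)[OF that] by auto
  show "\<bar>nonlin c n\<bar> \<le> K * M"
  proof (rule coeff_bound[OF *(3,1,2)])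
    show "\<bar>cos_series (nonlin c) z\<bar> \<le> K * M" if "z \<in> {0..1}" for z
      using r[of z] that by auto
  qed
qed

lemma K_pos: "K > 0"
  using a_pos by simp

lemma continuous_on_nonlin:
  assumes "\<And>t. t \<in> S \<Longrightarrow> wbound C (c t)" "\<And>n. continuous_on S (\<lambda>t. c t n)"
  shows "continuous_on S (\<lambda>t::real. nonlin (c t) n)"
  unfolding nonlin_def
  by (intro continuous_intros assms(2) continuous_on_conv[where A = "conv_const * C * C" and B = C]
      continuous_on_conv[where A = C and B = C] wbound_conv assms(1))

lemma seed_admissible: "admissible seed"
  unfolding admissible_def
proof (intro conjI allI impI)
  show "wbound B seed"
    unfolding wbound_def
  proof
    fix n
    have "\<bar>seed n\<bar> \<le> E * wt n" using wboundD[OF wbound_derivs(1)[OF wbound_seed']] .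
    also have "\<dots> \<le> B * wt n"
      using mu_pos M_pos a_pos wt_pos[of n] by (intro mult_right_mono) (auto simp: B_def)
    finally show "\<bar>seed n\<bar> \<le> B * wt n" .
  qed
  fix z :: real assume "\<bar>z\<bar> \<le> 1"
  then show "0 \<le> cos_series seed z" "cos_series seed z \<le> M"
    using seed_range[of z] eps_le_M by auto
qed (rule even_seed odd_seed)+

definition step :: "(real \<Rightarrow> int \<Rightarrow> real) \<Rightarrow> real \<Rightarrow> int \<Rightarrow> real" where
  "step c = duhamel \<mu> K seed (\<lambda>t. nonlin (c t))"

definition good :: "(real \<Rightarrow> int \<Rightarrow> real) \<Rightarrow> bool" where
  "good c \<longleftrightarrow> (\<forall>t\<ge>0. admissible (c t)) \<and> (\<forall>n. continuous_on {0..} (\<lambda>t. c t n))"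

lemma good_wbound: "good c \<Longrightarrow> t \<ge> 0 \<Longrightarrow> wbound B (c t)"
  by (simp add: good_def admissible_def)

lemma good_continuous_nonlin: "good c \<Longrightarrow> continuous_on {0..} (\<lambda>t. nonlin (c t) n)"
  by (rule continuous_on_nonlin[where C = B]) (auto simp: good_def admissible_def)

lemma step_modes:
  assumes "good c"
  shows "linear_modes \<mu> K (step c) (\<lambda>t. nonlin (c t)) (E + nonlin_bound B / min \<mu> K) (nonlin_bound B)"
  unfolding step_def
  by (rule linear_modes_duhamel[OF mu_pos K_pos good_continuous_nonlin[OF assms] _ wbound_seed'])
    (use assms admissible_nonlin(3) in \<open>auto simp: good_def\<close>)

lemma step_0: "step c 0 = seed"
  by (rule ext) (simp add: step_def)

lemma good_step:
  assumes "good c"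
  shows "good (step c)"
proof -
  have adm: "admissible (c t)" if "t \<ge> 0" for t using assms that by (simp add: good_def)
  interpret linear_modes \<mu> K "step c" "\<lambda>t. nonlin (c t)" "E + nonlin_bound B / min \<mu> K" "nonlin_bound B"
    by (rule step_modes[OF assms])
  have ev: "even_seq (step c t)" and od: "odd_supp (step c t)" for t
    unfolding step_def
    using duhamel_even[OF even_seed] duhamel_odd_supp[OF odd_seed] admissible_nonlin(1,2)[OF adm] by auto
  have "wbound B (step c t)" if "t \<ge> 0" for t
    unfolding step_def B_def
    using good_continuous_nonlin[OF assms] that admissible_nonlin(7)[OF adm] wbound_seed'
    by (intro wbound_duhamel mu_pos K_pos) auto
  moreover have "0 \<le> cos_series (step c t) z" if "t \<ge> 0" "\<bar>z\<bar> \<le> 1" for t z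
    using solution_ge[of 0 t z] od that admissible_nonlin(5)[OF adm] seed_range(1) by (auto simp: step_0)
  moreover have "cos_series (step c t) z \<le> M" if "t \<ge> 0" "\<bar>z\<bar> \<le> 1" for t z
  proof (rule linear_modes_le[OF step_modes[OF assms]])
    show "cos_series (step c 0) z \<le> M" if "\<bar>z\<bar> \<le> 1" for z
      using seed_range(2)[OF that] eps_le_M by (simp add: step_0)
    show "cos_series (nonlin (c t)) z \<le> K * M" if "t > 0" "\<bar>z\<bar> < 1" for t z
      using admissible_nonlin(6)[OF adm[of t], of z] that by auto
  qed (use od M_pos that in auto)
  ultimately show ?thesis
    using ev od cont_c by (auto simp: good_def admissible_def)
qed

fun iterate :: "nat \<Rightarrow> real \<Rightarrow> int \<Rightarrow> real" where
  "iterate 0 = (\<lambda>t. seed)"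
| "iterate (Suc j) = step (iterate j)"

lemma good_iterate: "good (iterate j)"
  by (induction j) (use good_step seed_admissible in \<open>auto simp: good_def\<close>)

lemma seed_modes:
  "linear_modes \<mu> K (\<lambda>t. seed) (\<lambda>t n. (\<mu> * (pi / 2)\<^sup>2 + K) * seed n) E (\<bar>\<mu> * (pi / 2)\<^sup>2 + K\<bar> * \<epsilon>)"
proof
  show "wbound (\<bar>\<mu> * (pi / 2)\<^sup>2 + K\<bar> * \<epsilon>) (\<lambda>n. (\<mu> * (pi / 2)\<^sup>2 + K) * seed n)" for t
    by (rule wbound_cmult[OF wbound_seed])
  show "((\<lambda>s. seed n) has_real_derivative
      - (\<mu> * (freq n)\<^sup>2 + K) * seed n + (\<mu> * (pi / 2)\<^sup>2 + K) * seed n) (at t)" for t n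
  proof -
    have "- (\<mu> * (freq n)\<^sup>2 + K) * seed n + (\<mu> * (pi / 2)\<^sup>2 + K) * seed n = 0"
      by (subst freq_sq_seed[of "\<lambda>r. - (\<mu> * r + K)" n]) (unfold mult_minus_left, rule left_minus)
    then show ?thesis by (simp only: DERIV_const)
  qed
qed (use mu_pos K_pos wbound_seed' in auto)

lemma iterate_mono:
  assumes "t \<ge> 0" "\<bar>z\<bar> \<le> 1"
  shows "cos_series (iterate j t) z \<le> cos_series (iterate (Suc j) t) z"
  using assms
proof (induction j arbitrary: t z)
  case 0
  have "cos_series ((\<lambda>t. seed) t) z \<le> cos_series (step (\<lambda>t. seed) t) z"
  proof (rule linear_modes_mono[OF seed_modes step_modes])
    show g: "good (\<lambda>t. seed)" using good_iterate[of 0] by simp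
    show "odd_supp (step (\<lambda>t. seed) t)" if "t \<ge> 0" for t
      using good_step[OF g] that by (simp add: good_def admissible_def)
    show "cos_series (\<lambda>n. (\<mu> * (pi / 2)\<^sup>2 + K) * seed n) z \<le> cos_series (nonlin seed) z"
      if "\<bar>z\<bar> < 1" for z
    proof -
      define v where "v = cos_series seed z"
      have v: "0 \<le> v" "v \<le> \<epsilon>" using seed_range[of z] that by (auto simp: v_def)
      then have "v\<^sup>2 \<le> \<epsilon>\<^sup>2" by (intro power_mono) auto
      then have "v\<^sup>2 \<le> a - \<mu> * pi\<^sup>2 / 4" using eps_le by linarith
      then have "0 \<le> v * (a - \<mu> * pi\<^sup>2 / 4 - v\<^sup>2)" using v by (intro mult_nonneg_nonneg) auto
      then have "(\<mu> * (pi / 2)\<^sup>2 + K) * v \<le> F v"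
        by (simp add: F_def power2_eq_square power3_eq_cube algebra_simps)
      then show ?thesis
        using admissible_nonlin(4)[OF seed_admissible] by (simp add: cos_series_cmult v_def)
    qed
  qed (use 0 odd_seed step_0 in auto)
  then show ?case by simp
next
  case (Suc j)
  have ad: "admissible (iterate j t)" if "t \<ge> 0" for j t
    using good_iterate[of j] that by (simp add: good_def)
  have "cos_series (step (iterate j) t) z \<le> cos_series (step (iterate (Suc j)) t) z"
  proof (rule linear_modes_mono[OF step_modes[OF good_iterate] step_modes[OF good_iterate]])
    show "odd_supp (step (iterate i) t)" if "t \<ge> 0" for i t
      using ad[of t "Suc i"] that by (simp add: admissible_def)
    then show "odd_supp (step (iterate i) t)" if "t \<ge> 0" for i t
      using that .
    show "cos_series (nonlin (iterate j t)) z \<le> cos_series (nonlin (iterate (Suc j) t)) z"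
      if t: "t > 0" and z: "\<bar>z\<bar> < 1" for t z
    proof -
      have "F (cos_series (iterate j t) z) \<le> F (cos_series (iterate (Suc j) t) z)"
        using Suc.IH[of t z] ad[of t j] ad[of t "Suc j"] t z
        by (intro F_mono) (auto simp: admissible_def)
      then show ?thesis
        by (simp only: admissible_nonlin(4)[OF ad[OF less_imp_le[OF t]]])
    qed
  qed (use Suc.prems step_0 in auto)
  then show ?case by simp
qed

lemma iterate_convergent:
  assumes "t \<ge> 0"
  shows "\<exists>l. (\<lambda>j. iterate j t n) \<longlonglongrightarrow> l"
proof (cases "even n")
  case True
  then have "iterate j t n = 0" for j
    using good_iterate[of j] assms by (simp add: good_def admissible_def odd_supp_def)
  then show ?thesis by auto
next
  case False
  have ad: "even_seq (iterate j t)" "odd_supp (iterate j t)" "wbound B (iterate j t)"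
    "\<And>z. \<bar>z\<bar> \<le> 1 \<Longrightarrow> 0 \<le> cos_series (iterate j t) z \<and> cos_series (iterate j t) z \<le> M" for j
    using good_iterate[of j] assms by (auto simp: good_def admissible_def)
  have "\<exists>l. (\<lambda>j. cos_series (iterate j t) z) \<longlonglongrightarrow> l" if "z \<in> {0..1}" for z
  proof -
    have "incseq (\<lambda>j. cos_series (iterate j t) z)"
      using iterate_mono[OF assms, of z] that by (intro incseq_SucI) auto
    then show ?thesis
      using ad(4)[of z] that by (auto elim!: incseq_convergent[of _ M])
  qed
  then obtain x where x: "\<And>z. z \<in> {0..1} \<Longrightarrow> (\<lambda>j. cos_series (iterate j t) z) \<longlonglongrightarrow> x z" by metis
  have "(\<lambda>j. integral {0..1} (\<lambda>z. cos_series (iterate j t) z * cos (freq n * z))) \<longlonglongrightarrow>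
    integral {0..1} (\<lambda>z. x z * cos (freq n * z))"
  proof (rule dominated_convergence(2))
    show "(\<lambda>z. cos_series (iterate j t) z * cos (freq n * z)) integrable_on {0..1}" for j
      using continuous_on_cos_series_space[OF ad(3)]
      by (auto intro!: integrable_continuous_real continuous_intros)
    show "(\<lambda>z. M) integrable_on {0..1::real}" by (rule integrable_const_ivl)
    show "norm (cos_series (iterate j t) z * cos (freq n * z)) \<le> M" if "z \<in> {0..1}" for j z
    proof -
      have "\<bar>cos_series (iterate j t) z\<bar> \<le> M" using ad(4)[of z j] that by auto
      then show ?thesis
        using mult_mono[of "\<bar>cos_series (iterate j t) z\<bar>" M "\<bar>cos (freq n * z)\<bar>" 1] M_pos
        by (simp add: abs_mult)
    qed
    show "(\<lambda>j. cos_series (iterate j t) z * cos (freq n * z)) \<longlonglongrightarrow> x z * cos (freq n * z)"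
      if "z \<in> {0..1}" for z
      by (intro tendsto_mult x that tendsto_const)
  qed
  moreover have "integral {0..1} (\<lambda>z. cos_series (iterate j t) z * cos (freq n * z)) = iterate j t n" for j
    using coeff_eq_integral[OF ad(3,1,2) False] by simp
  ultimately show ?thesis by auto
qed

definition limit :: "real \<Rightarrow> int \<Rightarrow> real" where
  "limit t n = lim (\<lambda>j. iterate j t n)"

lemma tendsto_limit: "t \<ge> 0 \<Longrightarrow> (\<lambda>j. iterate j t n) \<longlonglongrightarrow> limit t n"
  unfolding limit_def using iterate_convergent[of t n] by (auto simp: limI)

lemma wbound_iterate: "t \<ge> 0 \<Longrightarrow> wbound B (iterate j t)"
  using good_iterate good_wbound by blast

lemma tendsto_nonlin:
  assumes "t \<ge> 0"
  shows "(\<lambda>j. nonlin (iterate j t) n) \<longlonglongrightarrow> nonlin (limit t) n"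
  unfolding nonlin_def
  by (intro tendsto_intros tendsto_limit assms
      tendsto_conv[where A = "conv_const * B * B" and B = B] tendsto_conv[where A = B and B = B]
      wbound_conv wbound_iterate)

lemma limit_duhamel:
  assumes t: "t \<ge> 0"
  shows "(\<lambda>s. exp ((\<mu> * (freq n)\<^sup>2 + K) * s) * nonlin (limit s) n) integrable_on {0..t}" (is ?int)
    and "limit t n = duhamel \<mu> K seed (\<lambda>t. nonlin (limit t)) t n" (is ?eq)
proof -
  define \<rho> where "\<rho> = \<mu> * (freq n)\<^sup>2 + K"
  have "\<rho> \<ge> 0" using mu_pos K_pos by (simp add: \<rho>_def)
  have int: "(\<lambda>s. exp (\<rho> * s) * nonlin (iterate j s) n) integrable_on {0..t}" for j
    by (intro integrable_continuous_real continuous_intros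
        continuous_on_subset[OF good_continuous_nonlin[OF good_iterate]]) auto
  have bnd: "norm (exp (\<rho> * s) * nonlin (iterate j s) n) \<le> exp (\<rho> * t) * (K * M)" if "s \<in> {0..t}" for j s
    using that \<open>\<rho> \<ge> 0\<close> admissible_nonlin(7)[of "iterate j s" n] good_iterate[of j]
    by (auto simp: abs_mult good_def intro!: mult_mono mult_left_mono)
  have lim: "(\<lambda>j. exp (\<rho> * s) * nonlin (iterate j s) n) \<longlonglongrightarrow> exp (\<rho> * s) * nonlin (limit s) n"
    if "s \<in> {0..t}" for s
    using that by (intro tendsto_mult tendsto_const tendsto_nonlin) auto
  note dc = dominated_convergence[OF int _ bnd lim, OF integrable_const_ivl]
  show ?int using dc(1) by (simp add: \<rho>_def)
  have "(\<lambda>j. iterate (Suc j) t n) \<longlonglongrightarrow> duhamel \<mu> K seed (\<lambda>t. nonlin (limit t)) t n"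
    unfolding iterate.simps step_def duhamel_def
    by (intro tendsto_intros dc(2)[unfolded \<rho>_def])
  then show ?eq
    using LIMSEQ_unique LIMSEQ_Suc[OF tendsto_limit[OF t]] by blast
qed

definition solution :: "real \<Rightarrow> int \<Rightarrow> real" where
  "solution = duhamel \<mu> K seed (\<lambda>t. nonlin (limit t))"

lemma solution_eq_limit: "t \<ge> 0 \<Longrightarrow> solution t = limit t"
  using limit_duhamel(2) by (auto simp: solution_def)

lemma cont_limit: "continuous_on {0..} (\<lambda>t. limit t n)"
proof -
  have "continuous_on {0..} (\<lambda>t. solution t n)"
    unfolding solution_def
  proof (rule continuous_on_duhamel)
    show "(\<lambda>s. exp ((\<mu> * (freq n)\<^sup>2 + K) * s) * nonlin (limit s) n) integrable_on {0..t}" for t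
      using limit_duhamel(1)[of t n] by (cases "t \<ge> 0") auto
  qed
  then show ?thesis
    by (rule continuous_on_eq) (auto simp: solution_eq_limit)
qed

lemma wbound_lim: "t \<ge> 0 \<Longrightarrow> wbound B (limit t)"
  by (rule wbound_limit[OF wbound_iterate tendsto_limit])

lemma even_lim: "t \<ge> 0 \<Longrightarrow> even_seq (limit t)"
  and odd_lim: "t \<ge> 0 \<Longrightarrow> odd_supp (limit t)"
proof -
  assume t: "t \<ge> 0"
  have ad: "even_seq (iterate j t)" "odd_supp (iterate j t)" for j
    using good_iterate[of j] t by (auto simp: good_def admissible_def)
  show "even_seq (limit t)"
    using ad(1) unfolding even_seq_def limit_def by simp
  show "odd_supp (limit t)"
    using ad(2) unfolding odd_supp_def limit_def by simp
qed

lemma limit_ge_seed: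
  assumes "t \<ge> 0" "\<bar>z\<bar> \<le> 1"
  shows "cos_series seed z \<le> cos_series (limit t) z"
proof (rule LIMSEQ_le_const)
  show "(\<lambda>j. cos_series (iterate j t) z) \<longlonglongrightarrow> cos_series (limit t) z"
    unfolding cos_series_def
  proof (rule tendsto_infsum_dominated[OF summable_Bwt])
    show "\<bar>iterate j t n * cos (freq n * z)\<bar> \<le> B * wt n" for j n
      by (intro wbound_times_trig wbound_iterate assms) auto
  qed (auto intro!: tendsto_mult tendsto_limit assms)
  have "incseq (\<lambda>j. cos_series (iterate j t) z)"
    using iterate_mono[OF assms] by (rule incseq_SucI)
  then have "cos_series (iterate 0 t) z \<le> cos_series (iterate j t) z" for j
    by (rule incseqD) simp
  then show "\<exists>N. \<forall>j\<ge>N. cos_series seed z \<le> cos_series (iterate j t) z" by simp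
qed

lemma solution_modes:
  "linear_modes \<mu> K solution (\<lambda>t. nonlin (limit t)) (E + nonlin_bound B / min \<mu> K) (nonlin_bound B)"
  unfolding solution_def
  by (rule linear_modes_duhamel[OF mu_pos K_pos _ _ wbound_seed'])
    (auto intro!: wbound_nonlin wbound_lim continuous_on_nonlin cont_limit)

lemma classical_solution_growing:
  "classical_solution \<mu> a (\<lambda>t. 0) (\<lambda>t. cos_series (solution t))"
proof -
  interpret linear_modes \<mu> K solution "\<lambda>t. nonlin (limit t)" "E + nonlin_bound B / min \<mu> K" "nonlin_bound B"
    by (rule solution_modes)
  have c: "continuous_on ({0..} \<times> {0..1}) (\<lambda>(t, z). cos_series (solution t) z)"
    by (rule continuous_solution)
  have sub: "continuous_on ({0<..} \<times> {0..1}) f" if "continuous_on ({0..} \<times> {0..1}) f" for f :: "real \<times> real \<Rightarrow> real"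
    by (rule continuous_on_subset[OF that]) auto
  have pde: "cos_series (c' t) z = \<mu> * cos_series (\<lambda>n. - ((freq n)\<^sup>2 * solution t n)) z
      + a * cos_series (solution t) z - cos_series (solution t) z ^ 3" if "t > 0" for t z
    using cos_series_c'[of t z] cos_series_nonlin[OF wbound_lim even_lim, of t z] that
    by (simp add: solution_eq_limit F_def)
  have bc0: "sin_deriv_series (solution t) 0 = 0" for t
    unfolding sin_deriv_series_def by (rule infsum_0) simp
  have bc1: "cos_series (solution t) 1 = 0" if "t > 0" for t
    using cos_series_1[OF odd_lim] that by (simp add: solution_eq_limit)
  show ?thesis
    unfolding classical_solution_def
  proof (rule conjI[OF c], rule exI[of _ "\<lambda>t. cos_series (c' t)"],
      rule exI[of _ "\<lambda>t. sin_deriv_series (solution t)"],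
      rule exI[of _ "\<lambda>t. cos_series (\<lambda>n. - ((freq n)\<^sup>2 * solution t n))"],
      intro conjI allI impI ballI)
    fix t z :: real assume t: "t > 0" and "z \<in> {0..1}"
    show "((\<lambda>s. cos_series (solution s) z) has_real_derivative cos_series (c' t) z) (at t)"
      by (rule time_deriv[OF t])
    show "(cos_series (solution t) has_real_derivative sin_deriv_series (solution t) z) (at z within {0..1})"
      by (rule has_field_derivative_at_within[OF space_deriv(1)[OF less_imp_le[OF t]]])
    show "(sin_deriv_series (solution t) has_real_derivative
        cos_series (\<lambda>n. - ((freq n)\<^sup>2 * solution t n)) z) (at z within {0..1})"
      by (rule has_field_derivative_at_within[OF space_deriv(2)[OF less_imp_le[OF t]]])
  qed (use pde bc0 bc1 in \<open>auto intro!: sub continuous_solution\<close>)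
qed

lemma solution_0: "cos_series (solution 0) z = \<epsilon> * cos (pi / 2 * z)"
proof -
  have "solution 0 = seed" by (rule ext) (simp add: solution_def)
  then show ?thesis by (simp add: cos_series_seed)
qed

lemma solution_ge_initial:
  assumes "t \<ge> 0" "\<bar>z\<bar> \<le> 1"
  shows "\<epsilon> * cos (pi / 2 * z) \<le> cos_series (solution t) z"
  using limit_ge_seed[OF assms] assms by (simp add: solution_eq_limit cos_series_seed)

end

lemma not_zero_UAS_if_greater:
  assumes "\<mu> > 0" "a > \<mu> * pi\<^sup>2 / 4"
  shows "\<not> zero_UAS \<mu> a"
proof
  assume "zero_UAS \<mu> a"
  then obtain \<beta> r where \<beta>: "\<beta> \<in> class_KL" and r: "r > 0"
    and stable: "\<And>x t. classical_solution \<mu> a (\<lambda>t. 0) x \<Longrightarrow> L2_norm (x 0) \<le> r \<Longrightarrow> t \<ge> 0 \<Longrightarrow>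
      L2_norm (x t) \<le> \<beta> (L2_norm (x 0)) t"
    unfolding zero_UAS_def by blast
  define \<epsilon> where "\<epsilon> = min r (sqrt (a - \<mu> * pi\<^sup>2 / 4))"
  have eps: "\<epsilon> > 0" "\<epsilon> \<le> r" using r assms by (auto simp: \<epsilon>_def)
  have "\<epsilon>\<^sup>2 \<le> (sqrt (a - \<mu> * pi\<^sup>2 / 4))\<^sup>2"
    using eps by (intro power_mono) (auto simp: \<epsilon>_def)
  then interpret unstable \<mu> a \<epsilon>
    using assms eps by unfold_locales auto
  define x where "x t = cos_series (solution t)" for t
  have sol: "classical_solution \<mu> a (\<lambda>t. 0) x"
    unfolding x_def[abs_def] by (rule classical_solution_growing)
  have x0: "x 0 z = \<epsilon> * cos (pi / 2 * z)" for z by (simp add: x_def solution_0)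
  have cont: "continuous_on {0..1} (x t)" if "t \<ge> 0" for t
    using sol that continuous_on_slice[of "{0..}" "{0..1}" x t] by (auto simp: classical_solution_def)
  have cos_nonneg: "0 \<le> cos (pi / 2 * z)" if "z \<in> {0..1}" for z
    using seed_range(1)[of z] that eps by (simp add: cos_series_seed zero_le_mult_iff)
  have int: "(\<lambda>z. (x t z)\<^sup>2) integrable_on {0..1}" if "t \<ge> 0" for t
    by (intro integrable_continuous_real continuous_intros cont that)
  have norm: "L2_norm (x t) = sqrt (integral {0..1} (\<lambda>z. (x t z)\<^sup>2))" if "t \<ge> 0" for t
    by (rule L2_norm_eq[OF cont[OF that]])
  have "(x 0 z)\<^sup>2 = \<epsilon>\<^sup>2 * (cos (freq 1 * z) * cos (freq 1 * z))" for z
    unfolding x0 by (simp add: power_mult_distrib freq_def power2_eq_square)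
  then have "integral {0..1} (\<lambda>z. (x 0 z)\<^sup>2) = \<epsilon>\<^sup>2 * integral {0..1} (\<lambda>z. cos (freq 1 * z) * cos (freq 1 * z))"
    by (simp only: integral_mult_right)
  also have "\<dots> = \<epsilon>\<^sup>2 / 2" by (simp add: integral_cos_cos)
  finally have V0: "integral {0..1} (\<lambda>z. (x 0 z)\<^sup>2) = \<epsilon>\<^sup>2 / 2" .
  define l where "l = L2_norm (x 0)"
  have l: "l = sqrt (\<epsilon>\<^sup>2 / 2)" using norm V0 by (simp add: l_def)
  have "l > 0" using eps by (simp add: l)
  have "l \<le> sqrt (\<epsilon>\<^sup>2)" unfolding l by (rule real_sqrt_le_mono) simp
  then have "l \<le> r" using eps by simp
  have ge: "l \<le> L2_norm (x t)" if "t \<ge> 0" for t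
    unfolding l_def norm[OF that] norm[OF order_refl]
  proof (rule real_sqrt_le_mono, rule integral_le[OF int int[OF that]])
    fix z :: real assume z: "z \<in> {0..1}"
    have "0 \<le> x 0 z" using cos_nonneg[OF z] eps by (simp add: x0)
    moreover have "x 0 z \<le> x t z"
      unfolding x0 unfolding x_def using z that by (intro solution_ge_initial) auto
    ultimately show "(x 0 z)\<^sup>2 \<le> (x t z)\<^sup>2" by (intro power_mono)
  qed simp
  have "(\<beta> l \<longlongrightarrow> 0) at_top" using \<beta> \<open>l > 0\<close> by (simp add: class_KL_def)
  then have "\<forall>\<^sub>F t in at_top. \<beta> l t < l" using \<open>l > 0\<close> by (rule order_tendstoD)
  then obtain t where t: "t \<ge> 0" "\<beta> l t < l"
    unfolding eventually_at_top_linorder by (meson max.cobounded1 max.cobounded2)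
  have "L2_norm (x t) \<le> \<beta> l t"
    using stable[OF sol _ t(1)] \<open>l \<le> r\<close> by (simp add: l_def)
  with ge[OF t(1)] t(2) show False by linarith
qed

theorem proposition5p10:
  fixes \<mu> a :: real
  assumes "\<mu> > 0"
  shows "(a < \<mu> * pi\<^sup>2 / 4 \<longrightarrow> ISS \<mu> a) \<and> (a > \<mu> * pi\<^sup>2 / 4 \<longrightarrow> \<not> zero_UAS \<mu> a)"
  using assms ISS_if_less not_zero_UAS_if_greater by blast

end
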